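(* Let $u:\mathbb{H}^2\to\mathbb{R}$ be a smooth function and let $S=\mathrm{gr}(u)\subset\mathbb{HP}^3$ be its graph, and suppose that $V_S$ is a harmonic Lagrangian vector field on $\mathbb{H}^2$. Assume that $\lVert\overline{\partial}V_S\rVert_\infty$ is finite. Then the boundary at infinity of $S$ is the graph of a continuous function $\phi:\mathbb{S}^1\to\mathbb{R}$. Moreover, $V_S=\mathrm{HL}(X)$ extends continuously to the vector field $X(z)=iz\,\phi(z)$ on $\mathbb{S}^1$.
   Context: Minkowski space $\mathbb{R}^{1,2}$ is $\mathbb{R}^3$ with $\langle x,y\rangle_{1,2}=-x_0y_0+x_1y_1+x_2y_2$. The hyperbolic plane is $\mathbb{H}^2=\{x\in\mathbb{R}^{1,2}: \langle x,x\rangle_{1,2}=-1,\ x_0>0\}$ with the induced Riemannian metric $g$, Levi-Civita connection $\nabla$ and complex structure $\mathrm{J}_p(v)=p\boxtimes v$, where $\langle x\boxtimes y,v\rangle_{1,2}=\det(x,y,v)$ for all $v$. $\Delta$ is the Laplace-Beltrami operator ($\Delta=\mathrm{tr}\,\mathrm{Hess}$). $\mathbb{D}^2\subset\mathbb{R}^2\cong\mathbb{C}$ is the open unit disk, $\mathbb{S}^1=\partial\mathbb{D}^2$, $\Pi:\mathbb{H}^2\to\mathbb{D}^2$, $\Pi(x_0,x_1,x_2)=(x_1/x_0,x_2/x_0)$. Half-Pipe space $\mathbb{HP}^3$ is identified with $\mathbb{H}^2\times\mathbb{R}$, with Klein model $\mathbb{D}^2\times\mathbb{R}$; $\mathrm{gr}(u)$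 corresponds in the Klein model to the graph of $\overline{u}(\eta)=\sqrt{1-|\eta|^2}\,u(\Pi^{-1}(\eta))$, $\eta\in\mathbb{D}^2$. The boundary at infinity of $S=\mathrm{gr}(u)$ is the graph of $\phi$ when $\overline{u}$ extends continuously to $\overline{\mathbb{D}^2}$ with $\overline{u}|_{\mathbb{S}^1}=\phi$. For $\sigma\in\mathbb{R}^{1,2}$ let $\mathrm{P}_\sigma=\{(\eta,t)\in\mathbb{D}^2\times\mathbb{R}: \langle(1,\eta),\sigma\rangle_{1,2}=t\}$. For smooth $u$ and $S=\mathrm{gr}(u)$, the associated vector field is $V_S(p)=p\boxtimes\sigma_p$, where $\sigma_p$ is such that $\mathrm{P}_{\sigma_p}$ is the tangent plane of $\mathrm{gr}(\overline{u})$ at $(\Pi(p),\overline{u}(\Pi(p)))$. For a continuous vector field $X(z)=iz\,\phi_X(z)$ on $\mathbb{S}^1$ ($\phi_X:\mathbb{S}^1\to\mathbb{R}$), it is known that there is a unique smooth $u_X:\mathbb{H}^2\to\mathbb{R}$ with $\Delta u_X-2u_X=0$ and $\overline{u_X}$ extending continuously to $\overline{\mathbb{D}^2}$ with $\overline{u_X}|_{\mathbb{S}^1}=\phi_X$; then $\mathrm{HL}(X):=V_{S_X}$ with $S_X=\mathrm{gr}(u_X)$. For $(x,v)\in \mathrm{T}\mathbb{H}^2$, identify $\mathrm{T}_x\mathbb{H}^2\times \mathrm{T}_x\mathbb{H}^2\cong \mathrm{T}_{(x,v)}\mathrm{T}\mathbb{H}^2$ by $(w_1,w_2)\mapsto w_1^{\mathcal{H}}+w_2^{\mathcal{V}}$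 (horizontal lift of $w_1$ with respect to $\nabla$ plus vertical lift of $w_2$). Put $\mathbb{G}((X_1,X_2),(Y_1,Y_2))=g(X_1,Y_2)+g(X_2,Y_1)$ and $\Omega((X_1,X_2),(Y_1,Y_2))=g(\mathrm{J}X_1,Y_2)-g(X_2,\mathrm{J}Y_1)$. A smooth vector field $V$ is harmonic Lagrangian if $V:(\mathbb{H}^2,g)\to(\mathrm{T}\mathbb{H}^2,\mathbb{G})$ is a harmonic map (vanishing tension field $\mathrm{tr}_g\nabla^2V$, with $\nabla^2V(X,Y)=\nabla^{\mathbb{G}}_{\mathrm{d}V(X)}\mathrm{d}V(Y)-\mathrm{d}V(\nabla_XY)$) and $V^*\Omega=0$. $\overline{\partial}V(Y):=\frac12(\nabla_YV+\mathrm{J}\nabla_{\mathrm{J}Y}V)$; $\lVert\overline{\partial}V\rVert_\infty$ is the supremum over $p\in\mathbb{H}^2$ of the operator norm of $\overline{\partial}V$ on $(\mathrm{T}_p\mathbb{H}^2,g)$. A vector field $V$ on $\mathbb{H}^2$ extends continuously to $X$ if $\Pi_*V(\eta)=\mathrm{d}_{\Pi^{-1}(\eta)}\Pi(V(\Pi^{-1}(\eta)))\in\mathbb{R}^2$ satisfies $\Pi_*V(\eta_n)\to X(\eta_\infty)$ whenever $\eta_n\in\mathbb{D}^2$ converges to $\eta_\infty\in\mathbb{S}^1$. *)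

theory Defs
  imports "HOL-Analysis.Analysis"
begin

section \<open>Smooth functions and calculus in a global chart\<close>

fun Ck_fun :: "nat \<Rightarrow> ('a::real_normed_vector \<Rightarrow> 'b::real_normed_vector) \<Rightarrow> bool" where
  "Ck_fun 0 f \<longleftrightarrow> continuous_on UNIV f"
| "Ck_fun (Suc k) f \<longleftrightarrow> (\<forall>x. f differentiable (at x)) \<and>
     (\<forall>v. Ck_fun k (\<lambda>x. frechet_derivative f (at x) v))"

definition smooth_fun :: "('a::real_normed_vector \<Rightarrow> 'b::real_normed_vector) \<Rightarrow> bool" where
  "smooth_fun f \<longleftrightarrow> (\<forall>k. Ck_fun k f)"

definition partial_d :: "'n::finite \<Rightarrow> (real^'n \<Rightarrow> 'b::real_normed_vector) \<Rightarrow> real^'n \<Rightarrow> 'b" where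
  "partial_d i f x = frechet_derivative f (at x) (axis i 1)"

text \<open>A (pseudo-)Riemannian metric on \<open>\<real>\<^sup>n\<close> is given by its coefficient matrix \<open>G x\<close>;
  \<open>christoffel G x k i j\<close> is the coefficient \<open>\<Gamma>\<^sup>k\<^sub>i\<^sub>j\<close> at \<open>x\<close> of its Levi-Civita connection.\<close>

definition christoffel :: "(real^'n \<Rightarrow> real^'n^'n) \<Rightarrow> real^'n \<Rightarrow> 'n::finite \<Rightarrow> 'n \<Rightarrow> 'n \<Rightarrow> real" where
  "christoffel G x k i j = (1/2) * (\<Sum>l\<in>UNIV. matrix_inv (G x) $ k $ l *
     (partial_d i (\<lambda>y. G y $ j $ l) x + partial_d j (\<lambda>y. G y $ i $ l) x
      - partial_d l (\<lambda>y. G y $ i $ j) x))"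

text \<open>Components of \<open>\<nabla>\<^sup>2F(\<partial>\<^sub>i, \<partial>\<^sub>j) = \<nabla>\<^sup>h\<^bsub>dF(\<partial>\<^sub>i)\<^esub> dF(\<partial>\<^sub>j) - dF(\<nabla>\<^sup>g\<^bsub>\<partial>\<^sub>i\<^esub> \<partial>\<^sub>j)\<close>
  for a map \<open>F\<close> from \<open>(\<real>\<^sup>m, g)\<close> to \<open>(\<real>\<^sup>n, h)\<close>.\<close>

definition second_cov_deriv ::
  "(real^'m \<Rightarrow> real^'m^'m) \<Rightarrow> (real^'n \<Rightarrow> real^'n^'n) \<Rightarrow> (real^'m \<Rightarrow> real^'n)
   \<Rightarrow> real^'m \<Rightarrow> 'm::finite \<Rightarrow> 'm \<Rightarrow> real^'n::finite" where
  "second_cov_deriv g h F x i j =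
     (\<chi> a. partial_d i (partial_d j (\<lambda>y. F y $ a)) x
        + (\<Sum>b\<in>UNIV. \<Sum>c\<in>UNIV. christoffel h (F x) a b c
              * partial_d i (\<lambda>y. F y $ b) x * partial_d j (\<lambda>y. F y $ c) x))
     - (\<Sum>k\<in>UNIV. christoffel g x k i j *\<^sub>R partial_d k F x)"

definition tension_field ::
  "(real^'m \<Rightarrow> real^'m^'m) \<Rightarrow> (real^'n \<Rightarrow> real^'n^'n) \<Rightarrow> (real^'m \<Rightarrow> real^'n)
   \<Rightarrow> real^'m::finite \<Rightarrow> real^'n::finite" where
  "tension_field g h F x =
     (\<Sum>i\<in>UNIV. \<Sum>j\<in>UNIV. matrix_inv (g x) $ i $ j *\<^sub>R second_cov_deriv g h F x i j)"

definition harmonic_map ::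
  "(real^'m \<Rightarrow> real^'m^'m) \<Rightarrow> (real^'n \<Rightarrow> real^'n^'n) \<Rightarrow> (real^'m::finite \<Rightarrow> real^'n::finite) \<Rightarrow> bool" where
  "harmonic_map g h F \<longleftrightarrow> smooth_fun F \<and> (\<forall>x. tension_field g h F x = 0)"


section \<open>Minkowski space and the hyperbolic plane\<close>

text \<open>The coordinates \<open>x\<^sub>0, x\<^sub>1, x\<^sub>2\<close> are \<open>x $ 1, x $ 2, x $ 3\<close>.\<close>

definition mink :: "real^3 \<Rightarrow> real^3 \<Rightarrow> real" where
  "mink x y = - (x $ 1 * y $ 1) + x $ 2 * y $ 2 + x $ 3 * y $ 3"

definition mcross :: "real^3 \<Rightarrow> real^3 \<Rightarrow> real^3" (infixl "\<boxtimes>" 70) where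
  "x \<boxtimes> y = (THE w. \<forall>v. mink w v = det (vector [x, y, v]))"

definition H2 :: "(real^3) set" where
  "H2 = {x. mink x x = -1 \<and> x $ 1 > 0}"

definition tangent_H2 :: "real^3 \<Rightarrow> (real^3) set" where
  "tangent_H2 p = {v. mink p v = 0}"

definition JJ :: "real^3 \<Rightarrow> real^3 \<Rightarrow> real^3" where
  "JJ p v = p \<boxtimes> v"

definition gnorm :: "real^3 \<Rightarrow> real" where
  "gnorm v = sqrt (mink v v)"

text \<open>Differential-geometric notions on \<open>H2\<close> are expressed in the global chart
  \<open>hchart\<close>, with inverse \<open>hparam\<close>. Since \<open>hchart\<close> is linear, it is also its own differential, so
  \<open>hchart v\<close> is the coordinate vector of a tangent vector \<open>v\<close>.\<close>

definition hchart :: "real^3 \<Rightarrow> real^2" where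
  "hchart x = vector [x $ 2, x $ 3]"

definition hparam :: "real^2 \<Rightarrow> real^3" where
  "hparam q = vector [sqrt (1 + (q $ 1)\<^sup>2 + (q $ 2)\<^sup>2), q $ 1, q $ 2]"

definition dparam :: "real^2 \<Rightarrow> real^2 \<Rightarrow> real^3" where
  "dparam q = frechet_derivative hparam (at q)"

definition hmetric :: "real^2 \<Rightarrow> real^2^2" where
  "hmetric q = (\<chi> i j. mink (dparam q (axis i 1)) (dparam q (axis j 1)))"

definition conn_H2 :: "real^2 \<Rightarrow> real^2 \<Rightarrow> real^2 \<Rightarrow> real^2" where
  "conn_H2 q \<xi> w = (\<chi> k. \<Sum>i\<in>UNIV. \<Sum>j\<in>UNIV. christoffel hmetric q k i j * \<xi> $ i * w $ j)"

definition smooth_H2 :: "(real^3 \<Rightarrow> real) \<Rightarrow> bool" where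
  "smooth_H2 u \<longleftrightarrow> smooth_fun (u \<circ> hparam)"

definition hess_H2 :: "(real^3 \<Rightarrow> real) \<Rightarrow> real^2 \<Rightarrow> 2 \<Rightarrow> 2 \<Rightarrow> real" where
  "hess_H2 u q i j = partial_d i (partial_d j (u \<circ> hparam)) q
     - (\<Sum>k\<in>UNIV. christoffel hmetric q k i j * partial_d k (u \<circ> hparam) q)"

definition laplace_H2 :: "(real^3 \<Rightarrow> real) \<Rightarrow> real^3 \<Rightarrow> real" where
  "laplace_H2 u p = (\<Sum>i\<in>UNIV. \<Sum>j\<in>UNIV.
     matrix_inv (hmetric (hchart p)) $ i $ j * hess_H2 u (hchart p) i j)"


section \<open>Vector fields on the hyperbolic plane\<close>

text \<open>A vector field is a function on \<open>\<real>\<^sup>3\<close> of which only the values on \<open>H2\<close> matter.\<close>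

definition vf_coords :: "(real^3 \<Rightarrow> real^3) \<Rightarrow> real^2 \<Rightarrow> real^2" where
  "vf_coords V q = hchart (V (hparam q))"

definition smooth_vector_field :: "(real^3 \<Rightarrow> real^3) \<Rightarrow> bool" where
  "smooth_vector_field V \<longleftrightarrow> (\<forall>p\<in>H2. V p \<in> tangent_H2 p) \<and> smooth_fun (vf_coords V)"

definition nabla :: "(real^3 \<Rightarrow> real^3) \<Rightarrow> real^3 \<Rightarrow> real^3 \<Rightarrow> real^3" where
  "nabla V p Y = (let q = hchart p; \<xi> = hchart Y in
     dparam q (frechet_derivative (vf_coords V) (at q) \<xi> + conn_H2 q \<xi> (vf_coords V q)))"

definition dbar :: "(real^3 \<Rightarrow> real^3) \<Rightarrow> real^3 \<Rightarrow> real^3 \<Rightarrow> real^3" where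
  "dbar V p Y = (1/2) *\<^sub>R (nabla V p Y + JJ p (nabla V p (JJ p Y)))"

definition opnorm_H2 :: "real^3 \<Rightarrow> (real^3 \<Rightarrow> real^3) \<Rightarrow> ennreal" where
  "opnorm_H2 p L = (SUP v \<in> {v \<in> tangent_H2 p. gnorm v \<le> 1}. ennreal (gnorm (L v)))"

definition dbar_norm :: "(real^3 \<Rightarrow> real^3) \<Rightarrow> ennreal" where
  "dbar_norm V = (SUP p\<in>H2. opnorm_H2 p (dbar V p))"


section \<open>The tangent bundle of the hyperbolic plane\<close>

text \<open>The chart of \<open>H2\<close> induces a global chart of its tangent bundle with values in
  \<open>real^(2+2)\<close>: the \<open>Inl\<close> coordinates are those of the base point, the \<open>Inr\<close>
  coordinates those of the tangent vector.\<close>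

definition base_part :: "real^(2+2) \<Rightarrow> real^2" where
  "base_part z = (\<chi> i. z $ Inl i)"

definition fibre_part :: "real^(2+2) \<Rightarrow> real^2" where
  "fibre_part z = (\<chi> i. z $ Inr i)"

definition join_parts :: "real^2 \<Rightarrow> real^2 \<Rightarrow> real^(2+2)" where
  "join_parts a b = (\<chi> i. case i of Inl k \<Rightarrow> a $ k | Inr k \<Rightarrow> b $ k)"

text \<open>Horizontal and vertical lifts at \<open>z\<close> of a vector tangent to \<open>H2\<close> at the base point of \<open>z\<close>.\<close>

definition hor_lift :: "real^(2+2) \<Rightarrow> real^3 \<Rightarrow> real^(2+2)" where
  "hor_lift z w = join_parts (hchart w) (- conn_H2 (base_part z) (hchart w) (fibre_part z))"

definition ver_lift :: "real^(2+2) \<Rightarrow> real^3 \<Rightarrow> real^(2+2)" where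
  "ver_lift z w = join_parts 0 (hchart w)"

definition hor_part :: "real^(2+2) \<Rightarrow> real^(2+2) \<Rightarrow> real^3" where
  "hor_part z \<zeta> = dparam (base_part z) (base_part \<zeta>)"

definition ver_part :: "real^(2+2) \<Rightarrow> real^(2+2) \<Rightarrow> real^3" where
  "ver_part z \<zeta> = dparam (base_part z)
     (fibre_part \<zeta> + conn_H2 (base_part z) (base_part \<zeta>) (fibre_part z))"

definition GG :: "real^(2+2) \<Rightarrow> real^(2+2) \<Rightarrow> real^(2+2) \<Rightarrow> real" where
  "GG z X Y = mink (hor_part z X) (ver_part z Y) + mink (ver_part z X) (hor_part z Y)"

definition Omega_TH2 :: "real^(2+2) \<Rightarrow> real^(2+2) \<Rightarrow> real^(2+2) \<Rightarrow> real" where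
  "Omega_TH2 z X Y = (let p = hparam (base_part z) in
     mink (JJ p (hor_part z X)) (ver_part z Y) - mink (ver_part z X) (JJ p (hor_part z Y)))"

definition GG_matrix :: "real^(2+2) \<Rightarrow> real^(2+2)^(2+2)" where
  "GG_matrix z = (\<chi> a b. GG z (axis a 1) (axis b 1))"

definition section_map :: "(real^3 \<Rightarrow> real^3) \<Rightarrow> real^2 \<Rightarrow> real^(2+2)" where
  "section_map V q = join_parts q (vf_coords V q)"

definition pullback_Omega :: "(real^3 \<Rightarrow> real^3) \<Rightarrow> real^2 \<Rightarrow> real^2 \<Rightarrow> real^2 \<Rightarrow> real" where
  "pullback_Omega V q \<xi> \<eta> = Omega_TH2 (section_map V q)
     (frechet_derivative (section_map V) (at q) \<xi>) (frechet_derivative (section_map V) (at q) \<eta>)"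

definition harmonic_Lagrangian :: "(real^3 \<Rightarrow> real^3) \<Rightarrow> bool" where
  "harmonic_Lagrangian V \<longleftrightarrow> smooth_vector_field V
     \<and> harmonic_map hmetric GG_matrix (section_map V)
     \<and> (\<forall>q \<xi> \<eta>. pullback_Omega V q \<xi> \<eta> = 0)"


section \<open>Graphs in Half-Pipe space\<close>

text \<open>The plane containing the unit disk is \<open>complex\<close>.\<close>

definition Klein :: "real^3 \<Rightarrow> complex" where
  "Klein x = Complex (x $ 2 / x $ 1) (x $ 3 / x $ 1)"

text \<open>In the Klein model of Half-Pipe space (unit disk times \<open>\<real>\<close>) the graph of \<open>u\<close> on \<open>H2\<close>
  becomes the graph of \<open>ubar u\<close>. Only values on the open unit disk matter.\<close>

definition ubar :: "(real^3 \<Rightarrow> real) \<Rightarrow> complex \<Rightarrow> real" where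
  "ubar u \<eta> = sqrt (1 - (cmod \<eta>)\<^sup>2) * u (inv_into H2 Klein \<eta>)"

text \<open>The boundary at infinity of the graph of \<open>u\<close> is the graph of \<open>\<phi>\<close>.\<close>

definition boundary_is_graph :: "(real^3 \<Rightarrow> real) \<Rightarrow> (complex \<Rightarrow> real) \<Rightarrow> bool" where
  "boundary_is_graph u \<phi> \<longleftrightarrow> (\<exists>f. continuous_on (cball 0 1) f
     \<and> (\<forall>\<eta>\<in>ball 0 1. f \<eta> = ubar u \<eta>) \<and> (\<forall>z\<in>sphere 0 1. f z = \<phi> z))"

definition dual_plane :: "real^3 \<Rightarrow> (complex \<times> real) set" where
  "dual_plane \<sigma> = {(\<eta>, t). \<eta> \<in> ball 0 1 \<and> mink (vector [1, Re \<eta>, Im \<eta>]) \<sigma> = t}"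

definition tangent_plane :: "(complex \<Rightarrow> real) \<Rightarrow> complex \<Rightarrow> (complex \<times> real) set" where
  "tangent_plane f \<eta> = {(\<zeta>, t). \<zeta> \<in> ball 0 1 \<and> t = f \<eta> + frechet_derivative f (at \<eta>) (\<zeta> - \<eta>)}"

text \<open>\<open>V_gr u\<close> is the vector field associated with the graph of \<open>u\<close>.\<close>

definition V_gr :: "(real^3 \<Rightarrow> real) \<Rightarrow> real^3 \<Rightarrow> real^3" where
  "V_gr u p = p \<boxtimes> (THE \<sigma>. dual_plane \<sigma> = tangent_plane (ubar u) (Klein p))"

text \<open>Functions on \<open>H2\<close> are made unique by requiring them to be \<open>extensional\<close>.\<close>

definition u_ext :: "(complex \<Rightarrow> complex) \<Rightarrow> real^3 \<Rightarrow> real" where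
  "u_ext X = (THE u. u \<in> extensional H2 \<and> smooth_H2 u
     \<and> (\<forall>p\<in>H2. laplace_H2 u p - 2 * u p = 0)
     \<and> (\<exists>\<phi>. (\<forall>z\<in>sphere 0 1. X z = \<i> * z * of_real (\<phi> z)) \<and> boundary_is_graph u \<phi>))"

definition HL :: "(complex \<Rightarrow> complex) \<Rightarrow> real^3 \<Rightarrow> real^3" where
  "HL X = V_gr (u_ext X)"

definition Klein_push :: "(real^3 \<Rightarrow> real^3) \<Rightarrow> complex \<Rightarrow> complex" where
  "Klein_push V \<eta> = (let p = inv_into H2 Klein \<eta> in frechet_derivative Klein (at p) (V p))"

definition extends_continuously_to :: "(real^3 \<Rightarrow> real^3) \<Rightarrow> (complex \<Rightarrow> complex) \<Rightarrow> bool" where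
  "extends_continuously_to V X \<longleftrightarrow> (\<forall>\<eta> z. (\<forall>n::nat. \<eta> n \<in> ball 0 1) \<and> z \<in> sphere 0 1 \<and> \<eta> \<longlonglongrightarrow> z
     \<longrightarrow> (\<lambda>n. Klein_push V (\<eta> n)) \<longlonglongrightarrow> X z)"


section \<open>Consistency of the encodings\<close>

lemma mink_left_eqI: "w = w'" if "\<And>v. mink w v = mink w' v"
proof -
  have "w $ 1 = w' $ 1" using that[of "vector [1,0,0]"] by (simp add: mink_def)
  moreover have "w $ 2 = w' $ 2" using that[of "vector [0,1,0]"] by (simp add: mink_def)
  moreover have "w $ 3 = w' $ 3" using that[of "vector [0,0,1]"] by (simp add: mink_def)
  ultimately show ?thesis by (simp add: vec_eq_iff forall_3)
qed

lemma mink_mcross: "mink (x \<boxtimes> y) v = det (vector [x, y, v])"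
proof -
  let ?w = "vector [- (x$2 * y$3 - x$3 * y$2), x$3 * y$1 - x$1 * y$3, x$1 * y$2 - x$2 * y$1] :: real^3"
  have w: "\<forall>v. mink ?w v = det (vector [x, y, v])"
    by (simp add: mink_def det_3 algebra_simps)
  have "x \<boxtimes> y = ?w"
    unfolding mcross_def by (intro the_equality w) (metis mink_left_eqI w)
  with w show ?thesis by simp
qed

lemma hchart_hparam: "hchart (hparam q) = q"
  by (simp add: hchart_def hparam_def vec_eq_iff forall_2)

lemma hparam_in_H2: "hparam q \<in> H2"
proof -
  have "1 + (q $ 1)\<^sup>2 + (q $ 2)\<^sup>2 > 0" by (smt (verit) zero_le_power2)
  then show ?thesis
    by (simp add: H2_def mink_def hparam_def flip: power2_eq_square)
qed

lemma hparam_hchart: "hparam (hchart p) = p" if "p \<in> H2"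
proof -
  have "1 + (p $ 2)\<^sup>2 + (p $ 3)\<^sup>2 = (p $ 1)\<^sup>2" "p $ 1 > 0"
    using that by (auto simp: H2_def mink_def power2_eq_square)
  then show ?thesis
    by (simp add: hchart_def hparam_def vec_eq_iff forall_3)
qed

lemma bij_betw_hparam: "bij_betw hparam UNIV H2"
  by (rule bij_betw_byWitness[where f' = hchart])
     (auto simp: hchart_hparam hparam_hchart hparam_in_H2)

lemma hparam_has_derivative:
  "(hparam has_derivative (\<lambda>\<xi>. vector [(q $ 1 * \<xi> $ 1 + q $ 2 * \<xi> $ 2) / hparam q $ 1, \<xi> $ 1, \<xi> $ 2])) (at q)"
proof -
  have pos: "1 + (q $ 1)\<^sup>2 + (q $ 2)\<^sup>2 > 0" by (smt (verit) zero_le_power2)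
  have nth: "((\<lambda>q. q $ i) has_derivative (\<lambda>\<xi>. \<xi> $ i)) (at q)" for i :: 2
    by (rule bounded_linear_imp_has_derivative) (rule bounded_linear_vec_nth)
  have "((\<lambda>q. 1 + (q $ 1)\<^sup>2 + (q $ 2)\<^sup>2) has_derivative
      (\<lambda>\<xi>. 2 * (q $ 1 * \<xi> $ 1 + q $ 2 * \<xi> $ 2))) (at q)"
    using has_derivative_add[OF has_derivative_add[OF has_derivative_const
        has_derivative_power[OF nth[of 1], of 2]] has_derivative_power[OF nth[of 2], of 2]]
    by (simp add: algebra_simps)
  from DERIV_compose_FDERIV[OF DERIV_real_sqrt[OF pos] this]
  have root: "((\<lambda>q. sqrt (1 + (q $ 1)\<^sup>2 + (q $ 2)\<^sup>2)) has_derivative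
      (\<lambda>\<xi>. (q $ 1 * \<xi> $ 1 + q $ 2 * \<xi> $ 2) / sqrt (1 + (q $ 1)\<^sup>2 + (q $ 2)\<^sup>2))) (at q)"
    by (rule has_derivative_eq_rhs) (simp add: fun_eq_iff inverse_eq_divide del: distrib_left_numeral)
  have "((\<lambda>x. hparam x $ i) has_derivative
      (\<lambda>\<xi>. vector [(q $ 1 * \<xi> $ 1 + q $ 2 * \<xi> $ 2) / hparam q $ 1, \<xi> $ 1, \<xi> $ 2] $ i)) (at q)" for i
    using exhaust_3[of i] root nth[of 1] nth[of 2] by (auto simp: hparam_def)
  then show ?thesis
    by (subst has_derivative_componentwise_within) (auto simp: Basis_vec_def inner_axis)
qed

lemma dparam_eq: "dparam q \<xi> = vector [(q $ 1 * \<xi> $ 1 + q $ 2 * \<xi> $ 2) / hparam q $ 1, \<xi> $ 1, \<xi> $ 2]"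
  unfolding dparam_def by (rule fun_cong[OF frechet_derivative_at[OF hparam_has_derivative], symmetric])

lemma hchart_dparam: "hchart (dparam q \<xi>) = \<xi>"
  by (simp add: hchart_def dparam_eq vec_eq_iff forall_2)

lemma dparam_in_tangent_H2: "dparam q \<xi> \<in> tangent_H2 (hparam q)"
proof -
  have "hparam q $ 1 \<noteq> 0" using hparam_in_H2[of q] by (simp add: H2_def)
  moreover have "hparam q $ 2 = q $ 1" "hparam q $ 3 = q $ 2" by (simp_all add: hparam_def)
  ultimately show ?thesis
    by (simp add: tangent_H2_def mink_def dparam_eq)
qed

lemma dparam_hchart_tangent: "dparam q (hchart v) = v" if "v \<in> tangent_H2 (hparam q)"
proof -
  have "hparam q $ 1 \<noteq> 0" using hparam_in_H2[of q] by (simp add: H2_def)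
  moreover have "hparam q $ 2 = q $ 1" "hparam q $ 3 = q $ 2" by (simp_all add: hparam_def)
  then have "hparam q $ 1 * v $ 1 = q $ 1 * v $ 2 + q $ 2 * v $ 3"
    using that by (simp add: tangent_H2_def mink_def)
  ultimately have "v $ 1 = (q $ 1 * v $ 2 + q $ 2 * v $ 3) / hparam q $ 1"
    by (simp add: eq_divide_eq mult.commute)
  then show ?thesis
    by (simp add: dparam_eq hchart_def vec_eq_iff forall_3)
qed

lemma join_parts_simps [simp]:
  "base_part (join_parts a b) = a" "fibre_part (join_parts a b) = b"
  "join_parts (base_part z) (fibre_part z) = z"
  "join_parts a b + join_parts c d = join_parts (a + c) (b + d)"
  by (simp_all add: join_parts_def base_part_def fibre_part_def vec_eq_iff split: sum.split)

text \<open>\<open>hor_part z\<close> and \<open>ver_part z\<close> invert the identification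
  \<open>(w\<^sub>1, w\<^sub>2) \<mapsto> w\<^sub>1\<^sup>H + w\<^sub>2\<^sup>V\<close>.\<close>

lemma lift_parts: "hor_lift z (hor_part z \<zeta>) + ver_lift z (ver_part z \<zeta>) = \<zeta>"
  by (simp add: hor_lift_def ver_lift_def hor_part_def ver_part_def hchart_dparam)

lemma parts_lift:
  assumes "w1 \<in> tangent_H2 (hparam (base_part z))" "w2 \<in> tangent_H2 (hparam (base_part z))"
  shows "hor_part z (hor_lift z w1 + ver_lift z w2) = w1"
    and "ver_part z (hor_lift z w1 + ver_lift z w2) = w2"
  using assms
  by (simp_all add: hor_lift_def ver_lift_def hor_part_def ver_part_def dparam_hchart_tangent)

end

theory Submission
  imports Defs
begin

text \<open>
  Write \<open>f\<close> for \<open>u\<close> in the chart \<open>q = (x\<^sub>1, x\<^sub>2)\<close> of the hyperboloid, where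
  \<open>x\<^sub>0 = sqrt (1 + \<bar>q\<bar>\<^sup>2)\<close>, and \<open>L = \<Delta> - 2\<close>. The tangent planes of the graph of \<open>ubar u\<close> are dual to
  \<open>\<sigma>\<^sub>p = grad u - u p\<close>, so the field of the graph is the rotated gradient \<open>V = J grad u\<close>, which in the
  chart is \<open>x\<^sub>0 (- \<partial>\<^sub>2 f, \<partial>\<^sub>1 f)\<close> (\<open>V_gr_hparam\<close>). Three facts carry the theorem.

  First, \<open>L f\<close> is constant (\<open>massive_laplacian_eq_const\<close>). The metric of the tangent bundle is the
  complete lift of the hyperbolic one, and the vertical part of the tension field of a section is
  \<open>L\<close> applied to its coordinate functions plus a multiple of \<open>q\<close>, which vanishes for a rotated
  gradient. Hence harmonicity says \<open>L (x\<^sub>0 \<partial>\<^sub>k f) = 0\<close>. But \<open>x\<^sub>0 \<partial>\<^sub>k\<close> is the Killing field of a boost,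
  it commutes with \<open>L\<close>, and so \<open>\<partial>\<^sub>k (L f) = 0\<close>.

  Secondly, let \<open>B = Hess u - u g\<close>. Its trace is \<open>L f\<close> and the operator \<open>dbar V\<close> is \<open>J\<close> after the
  trace-free part of \<open>B\<close> (\<open>dbar_V_gr\<close>), so a bound on \<open>dbar V\<close> together with the first fact bounds
  \<open>B\<close>. On the other hand \<open>B\<close> is the derivative of the Euclidean gradient of \<open>ubar u\<close>
  (\<open>klein_grad_has_derivative\<close>). Integrating along rays, this gradient is at most \<open>C + M \<bar>q\<bar>\<close>, and
  \<open>\<bar>q\<bar> = r / sqrt (1 - r\<^sup>2)\<close> at distance \<open>r\<close> from the centre of the Klein disk. This is integrable in \<open>r\<close>,
  uniformly in the direction, so \<open>ubar u\<close> extends continuously to the closed disk (\<open>ubar_extends\<close>).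
  Since \<open>V\<close> is pushed to \<open>\<i> \<eta> ubar u + \<i> (1 - \<bar>\<eta>\<bar>\<^sup>2) grad (ubar u)\<close> (\<open>Klein_push_V_gr\<close>), and the second term is
  of order \<open>sqrt (1 - r\<^sup>2)\<close>, the field extends as claimed.

  Thirdly, adding a constant \<open>c\<close> to \<open>u\<close> leaves \<open>V\<close> unchanged and adds \<open>c sqrt (1 - \<bar>\<eta>\<bar>\<^sup>2)\<close> to \<open>ubar u\<close>,
  which is \<open>0\<close> on the circle. If \<open>L f = k\<close>, then \<open>u + k/2\<close> solves the homogeneous equation with the same
  boundary values, and the maximum principle shows that it is the only solution
  (\<open>boundary_value_unique\<close>). So \<open>V = HL X\<close>.
\<close>

section \<open>Partial derivatives\<close>

lemma partial_d_eq: "(f has_derivative D) (at x) \<Longrightarrow> partial_d i f x = D (axis i 1)"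
  unfolding partial_d_def by (metis frechet_derivative_at)

lemma has_derivative_component: "((\<lambda>x. x $ i) has_derivative (\<lambda>x. x $ i)) F"
  by (rule bounded_linear_imp_has_derivative) (rule bounded_linear_vec_nth)

lemma differentiable_vec_nth [simp]: "(\<lambda>x. x $ i) differentiable F"
  using has_derivative_component differentiable_def by blast

lemma partial_d_vec_nth [simp]: "partial_d i (\<lambda>x::real^'n. x $ j) x = of_bool (i = j)"
  by (subst partial_d_eq[OF has_derivative_component]) (simp add: axis_def)

lemma partial_d_const [simp]: "partial_d i (\<lambda>x. c) x = 0"
  by (subst partial_d_eq[OF has_derivative_const]) simp

lemma partial_d_const_fun: "partial_d i (\<lambda>x. c) = (\<lambda>x. 0)"
  by (simp add: fun_eq_iff)

context
  fixes f g :: "real^'n \<Rightarrow> real" and x :: "real^'n::finite" and i :: 'n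
  assumes f: "f differentiable (at x)" and g: "g differentiable (at x)"
begin

lemma partial_d_add: "partial_d i (\<lambda>x. f x + g x) x = partial_d i f x + partial_d i g x"
  using has_derivative_add[OF f[unfolded frechet_derivative_works] g[unfolded frechet_derivative_works]]
  by (subst partial_d_eq, assumption) (simp add: partial_d_def)

lemma partial_d_diff: "partial_d i (\<lambda>x. f x - g x) x = partial_d i f x - partial_d i g x"
  using has_derivative_diff[OF f[unfolded frechet_derivative_works] g[unfolded frechet_derivative_works]]
  by (subst partial_d_eq, assumption) (simp add: partial_d_def)

lemma partial_d_mult: "partial_d i (\<lambda>x. f x * g x) x = partial_d i f x * g x + f x * partial_d i g x"
  using has_derivative_mult[OF f[unfolded frechet_derivative_works] g[unfolded frechet_derivative_works]]
  by (subst partial_d_eq, assumption) (simp add: partial_d_def)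

lemma partial_d_divide: "g x \<noteq> 0 \<Longrightarrow>
    partial_d i (\<lambda>x. f x / g x) x = (partial_d i f x * g x - f x * partial_d i g x) / (g x)\<^sup>2"
  using has_derivative_divide'[OF f[unfolded frechet_derivative_works] g[unfolded frechet_derivative_works]]
  by (subst partial_d_eq, assumption) (simp add: partial_d_def power2_eq_square)

end

lemma partial_d_minus:
  assumes "f differentiable (at (x::real^'n::finite))"
  shows "partial_d i (\<lambda>x. - f x :: real) x = - partial_d i f x"
  using has_derivative_minus[OF assms[unfolded frechet_derivative_works]]
  by (subst partial_d_eq, assumption) (simp add: partial_d_def)

lemma partial_d_power2:
  assumes "f differentiable (at (x::real^'n::finite))"
  shows "partial_d i (\<lambda>x. (f x :: real)\<^sup>2) x = 2 * f x * partial_d i f x"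
  by (simp add: power2_eq_square partial_d_mult[OF assms assms])

lemmas partial_d_simps = partial_d_add partial_d_diff partial_d_mult partial_d_divide
  partial_d_minus partial_d_power2

lemma frechet_derivative_eq_sum_partial_d:
  fixes f :: "real^'n::finite \<Rightarrow> 'b::real_normed_vector"
  assumes "f differentiable (at x)"
  shows "frechet_derivative f (at x) v = (\<Sum>i\<in>UNIV. v $ i *\<^sub>R partial_d i f x)"
proof -
  interpret linear "frechet_derivative f (at x)"
    using assms by (rule linear_frechet_derivative)
  have "frechet_derivative f (at x) v = frechet_derivative f (at x) (\<Sum>i\<in>UNIV. v $ i *\<^sub>R axis i 1)"
    by (subst basis_expansion[symmetric]) (simp add: scalar_mult_eq_scaleR)
  then show ?thesis by (simp add: sum scale partial_d_def)
qed

lemma has_derivative_partial_d: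
  fixes f :: "real^2 \<Rightarrow> real"
  assumes "f differentiable (at x)"
  shows "(f has_derivative (\<lambda>v. v $ 1 * partial_d 1 f x + v $ 2 * partial_d 2 f x)) (at x)"
  using assms[unfolded frechet_derivative_works]
  by (rule has_derivative_eq_rhs)
     (simp add: fun_eq_iff frechet_derivative_eq_sum_partial_d[OF assms] sum_2)

lemma partial_d_component:
  fixes F :: "real^'n::finite \<Rightarrow> real^'m::finite"
  assumes "F differentiable (at x)"
  shows "partial_d i (\<lambda>x. F x $ k) x = partial_d i F x $ k"
proof -
  have "((\<lambda>x. F x $ k) has_derivative (\<lambda>v. frechet_derivative F (at x) v $ k)) (at x)"
    using has_derivative_compose[OF assms[unfolded frechet_derivative_works] has_derivative_component] .
  then show ?thesis by (subst partial_d_eq, assumption) (simp add: partial_d_def)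
qed

section \<open>Smooth functions\<close>

lemma smooth_funD:
  assumes "smooth_fun f"
  shows smooth_fun_differentiable: "f differentiable (at x)"
    and smooth_fun_frechet: "smooth_fun (\<lambda>x. frechet_derivative f (at x) v)"
    and smooth_fun_continuous: "continuous_on S f"
proof -
  have "Ck_fun (Suc k) f" for k using assms by (auto simp: smooth_fun_def)
  then show "f differentiable (at x)" "smooth_fun (\<lambda>x. frechet_derivative f (at x) v)"
    by (auto simp: smooth_fun_def)
  have "Ck_fun 0 f" using assms by (auto simp only: smooth_fun_def)
  then show "continuous_on S f" using continuous_on_subset by auto
qed

lemma smooth_fun_partial_d: "smooth_fun f \<Longrightarrow> smooth_fun (partial_d i f)"
  using smooth_fun_frechet[of f "axis i 1"] by (simp add: partial_d_def[abs_def])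

lemma smooth_fun_diff:
  assumes "smooth_fun f" "smooth_fun g"
  shows "smooth_fun (\<lambda>x. f x - g x)"
proof -
  have "Ck_fun k (\<lambda>x. f x - g x)" if "Ck_fun k f" "Ck_fun k g"
    for k and f g :: "'a \<Rightarrow> 'b"
    using that
  proof (induction k arbitrary: f g)
    case 0
    then show ?case by (simp add: continuous_on_diff)
  next
    case (Suc k)
    have "frechet_derivative (\<lambda>x. f x - g x) (at x) v
        = frechet_derivative f (at x) v - frechet_derivative g (at x) v" for x v
    proof -
      have "f differentiable (at x)" "g differentiable (at x)" using Suc.prems by simp_all
      then have "((\<lambda>x. f x - g x) has_derivative
          (\<lambda>v. frechet_derivative f (at x) v - frechet_derivative g (at x) v)) (at x)"
        by (intro has_derivative_diff) (simp_all add: frechet_derivative_works[symmetric])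
      from frechet_derivative_at[OF this] show ?thesis by metis
    qed
    then have "Ck_fun k (\<lambda>x. frechet_derivative (\<lambda>x. f x - g x) (at x) v)" for v
      using Suc.IH[of "\<lambda>x. frechet_derivative f (at x) v" "\<lambda>x. frechet_derivative g (at x) v"] Suc.prems
      by simp
    moreover have "(\<lambda>x. f x - g x) differentiable (at x)" for x
      using Suc.prems by (intro differentiable_diff) simp_all
    ultimately show ?case by simp
  qed
  with assms show ?thesis by (simp add: smooth_fun_def)
qed

lemma smooth_fun_const: "smooth_fun (\<lambda>x :: 'a::real_normed_vector. c :: 'b::real_normed_vector)"
proof -
  have "Ck_fun k (\<lambda>x :: 'a. c)" for k and c :: 'b
    by (induction k arbitrary: c) (auto simp: frechet_derivative_const)
  then show ?thesis by (simp add: smooth_fun_def)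
qed

section \<open>Symmetry of second derivatives\<close>

text \<open>Applying the mean value theorem in direction \<open>v\<close> and then in direction \<open>w\<close> turns a second
  difference into a second derivative at a nearby point. The second difference is symmetric in \<open>v\<close>
  and \<open>w\<close>, the right-hand side is not visibly so; letting \<open>h\<close> tend to 0 gives the symmetry of second
  derivatives.\<close>

lemma second_difference_mean_value:
  fixes f :: "'a::real_normed_vector \<Rightarrow> real"
  assumes f: "\<And>x. f differentiable (at x)"
    and fv: "\<And>x. (\<lambda>x. frechet_derivative f (at x) v) differentiable (at x)"
    and h: "h > 0"
  shows "\<exists>s t. 0 < s \<and> s < h \<and> 0 < t \<and> t < h \<and>
    f (x + h *\<^sub>R v + h *\<^sub>R w) - f (x + h *\<^sub>R v) - (f (x + h *\<^sub>R w) - f x)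
     = h * h * frechet_derivative (\<lambda>x. frechet_derivative f (at x) v) (at (x + s *\<^sub>R v + t *\<^sub>R w)) w"
proof -
  let ?fv = "\<lambda>x. frechet_derivative f (at x) v"
  have line: "((\<lambda>s. y + s *\<^sub>R v) has_derivative (\<lambda>s. s *\<^sub>R v)) (at s)" for y s and v :: 'a
    by (auto intro!: derivative_eq_intros)
  have along: "((\<lambda>s. F (y + s *\<^sub>R v)) has_derivative (\<lambda>t. t * frechet_derivative F (at (y + s *\<^sub>R v)) v)) (at s)"
    if "\<And>x. F differentiable (at x)" for F :: "'a \<Rightarrow> real" and y s v
  proof -
    have "((\<lambda>s. F (y + s *\<^sub>R v)) has_derivative (\<lambda>t. frechet_derivative F (at (y + s *\<^sub>R v)) (t *\<^sub>R v))) (at s)"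
      using has_derivative_compose[OF line that[unfolded frechet_derivative_works]] .
    then show ?thesis
      by (rule has_derivative_eq_rhs)
         (simp add: fun_eq_iff linear_cmul[OF linear_frechet_derivative[OF that]])
  qed
  let ?g = "\<lambda>s. f (x + h *\<^sub>R w + s *\<^sub>R v) - f (x + s *\<^sub>R v)"
  have dg: "(?g has_derivative (\<lambda>t. t * (?fv (x + h *\<^sub>R w + s *\<^sub>R v)) - t * ?fv (x + s *\<^sub>R v))) (at s)" for s
    using along[OF f] by (intro has_derivative_diff)
  obtain s where s: "0 < s" "s < h"
    "?g h - ?g 0 = (h - 0) * (?fv (x + h *\<^sub>R w + s *\<^sub>R v)) - (h - 0) * ?fv (x + s *\<^sub>R v)"
    by (rule mvt[OF h _ dg]) (rule has_derivative_continuous_on[OF has_derivative_at_withinI[OF dg]])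
  let ?k = "\<lambda>t. ?fv (x + s *\<^sub>R v + t *\<^sub>R w)"
  have dk: "(?k has_derivative (\<lambda>r. r * frechet_derivative ?fv (at (x + s *\<^sub>R v + t *\<^sub>R w)) w)) (at t)" for t
    using along[OF fv] .
  obtain t where t: "0 < t" "t < h" "?k h - ?k 0 = (h - 0) * frechet_derivative ?fv (at (x + s *\<^sub>R v + t *\<^sub>R w)) w"
    by (rule mvt[OF h _ dk]) (rule has_derivative_continuous_on[OF has_derivative_at_withinI[OF dk]])
  have "f (x + h *\<^sub>R v + h *\<^sub>R w) - f (x + h *\<^sub>R v) - (f (x + h *\<^sub>R w) - f x) = ?g h - ?g 0"
    by (simp add: add_ac)
  also have "\<dots> = h * (?k h - ?k 0)" using s(3) by (simp add: algebra_simps)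
  also have "\<dots> = h * h * frechet_derivative ?fv (at (x + s *\<^sub>R v + t *\<^sub>R w)) w"
    using t(3) by (simp only: diff_zero mult.assoc)
  finally show ?thesis using s(1,2) t(1,2) by blast
qed

lemma second_derivative_symmetric:
  fixes f :: "'a::real_normed_vector \<Rightarrow> real"
  assumes "smooth_fun f"
  shows "frechet_derivative (\<lambda>x. frechet_derivative f (at x) v) (at x) w
       = frechet_derivative (\<lambda>x. frechet_derivative f (at x) w) (at x) v" (is "?A x = ?B x")
proof -
  have diff: "f differentiable (at x)" "(\<lambda>x. frechet_derivative f (at x) v) differentiable (at x)" for x v
    using assms by (auto intro: smooth_fun_differentiable smooth_fun_frechet)
  define h where "h n = inverse (real (Suc n))" for n
  have h: "h n > 0" for n by (simp add: h_def)
  have h0: "h \<longlonglongrightarrow> 0" unfolding h_def by (rule LIMSEQ_inverse_real_of_nat)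
  have "\<exists>s t s' t'. 0 < s \<and> s < h n \<and> 0 < t \<and> t < h n \<and> 0 < s' \<and> s' < h n \<and> 0 < t' \<and> t' < h n \<and>
      ?A (x + s *\<^sub>R v + t *\<^sub>R w) = ?B (x + s' *\<^sub>R w + t' *\<^sub>R v)" for n
  proof -
    obtain s t where 1: "0 < s" "s < h n" "0 < t" "t < h n"
      "f (x + h n *\<^sub>R v + h n *\<^sub>R w) - f (x + h n *\<^sub>R v) - (f (x + h n *\<^sub>R w) - f x) = h n * h n * ?A (x + s *\<^sub>R v + t *\<^sub>R w)"
      using second_difference_mean_value[of f v "h n" x w] diff h by blast
    obtain s' t' where 2: "0 < s'" "s' < h n" "0 < t'" "t' < h n"
      "f (x + h n *\<^sub>R w + h n *\<^sub>R v) - f (x + h n *\<^sub>R w) - (f (x + h n *\<^sub>R v) - f x) = h n * h n * ?B (x + s' *\<^sub>R w + t' *\<^sub>R v)"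
      using second_difference_mean_value[of f w "h n" x v] diff h by blast
    have "x + h n *\<^sub>R v + h n *\<^sub>R w = x + h n *\<^sub>R w + h n *\<^sub>R v" by (simp add: add_ac)
    then have "f (x + h n *\<^sub>R v + h n *\<^sub>R w) = f (x + h n *\<^sub>R w + h n *\<^sub>R v)" by (rule arg_cong)
    then have "h n * h n * ?A (x + s *\<^sub>R v + t *\<^sub>R w) = h n * h n * ?B (x + s' *\<^sub>R w + t' *\<^sub>R v)"
      using 1(5) 2(5) by linarith
    then have "?A (x + s *\<^sub>R v + t *\<^sub>R w) = ?B (x + s' *\<^sub>R w + t' *\<^sub>R v)"
      using h[of n] by simp
    with 1 2 show ?thesis by blast
  qed
  then obtain s t s' t' where st: "\<And>n. 0 < s n \<and> s n < h n \<and> 0 < t n \<and> t n < h n \<and> 0 < s' n \<and> s' n < h n \<and> 0 < t' n \<and> t' n < h n \<and>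
      ?A (x + s n *\<^sub>R v + t n *\<^sub>R w) = ?B (x + s' n *\<^sub>R w + t' n *\<^sub>R v)" by metis
  have to0: "a \<longlonglongrightarrow> 0" if "\<And>n. 0 < a n \<and> a n < h n" for a
    by (rule tendsto_sandwich[OF _ _ tendsto_const h0]) (use that in \<open>auto intro!: always_eventually less_imp_le\<close>)
  have lims: "s \<longlonglongrightarrow> 0" "t \<longlonglongrightarrow> 0" "s' \<longlonglongrightarrow> 0" "t' \<longlonglongrightarrow> 0"
    by (rule to0; use st in blast)+
  have "(\<lambda>n. x + s n *\<^sub>R v + t n *\<^sub>R w) \<longlonglongrightarrow> x + 0 *\<^sub>R v + 0 *\<^sub>R w"
    by (intro tendsto_intros lims)
  moreover have "(\<lambda>n. x + s' n *\<^sub>R w + t' n *\<^sub>R v) \<longlonglongrightarrow> x + 0 *\<^sub>R w + 0 *\<^sub>R v"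
    by (intro tendsto_intros lims)
  moreover have "isCont ?A y" "isCont ?B y" for y
    using smooth_fun_continuous[OF smooth_fun_frechet[OF smooth_fun_frechet[OF assms]], of UNIV]
    by (auto simp: continuous_on_eq_continuous_at)
  ultimately have "(\<lambda>n. ?A (x + s n *\<^sub>R v + t n *\<^sub>R w)) \<longlonglongrightarrow> ?A x" "(\<lambda>n. ?B (x + s' n *\<^sub>R w + t' n *\<^sub>R v)) \<longlonglongrightarrow> ?B x"
    by (auto intro: isCont_tendsto_compose)
  with st show ?thesis by (metis (no_types, lifting) LIMSEQ_unique ext)
qed

lemma partial_d_commute:
  "smooth_fun (f :: real^'n::finite \<Rightarrow> real) \<Longrightarrow> partial_d i (partial_d j f) x = partial_d j (partial_d i f) x"
  unfolding partial_d_def[abs_def] by (rule second_derivative_symmetric)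

section \<open>The hyperboloid chart\<close>

text \<open>The square of the height \<open>x\<^sub>0\<close> of the point of the hyperboloid with chart coordinates \<open>q\<close>. It is kept
  as an opaque symbol while denominators are cleared, and unfolded only in polynomial identities.\<close>

definition hsq :: "real^2 \<Rightarrow> real" where
  "hsq q = 1 + (q $ 1)\<^sup>2 + (q $ 2)\<^sup>2"

abbreviation height :: "real^2 \<Rightarrow> real" where
  "height q \<equiv> sqrt (hsq q)"

lemma hsq_pos [simp]: "hsq q > 0" "hsq q \<noteq> 0"
  unfolding hsq_def by (smt (verit) zero_le_power2)+

lemma hsq_differentiable [simp]: "hsq differentiable (at q)"
  unfolding hsq_def[abs_def] by simp

lemma partial_d_hsq [simp]: "partial_d i hsq q = 2 * q $ i"
  using exhaust_2[of i] unfolding hsq_def[abs_def] by (auto simp: partial_d_simps)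

lemma has_derivative_height:
  "(height has_derivative (\<lambda>\<xi>. (q $ 1 * \<xi> $ 1 + q $ 2 * \<xi> $ 2) / height q)) (at q)"
  using DERIV_compose_FDERIV[OF DERIV_real_sqrt has_derivative_partial_d[of hsq q]]
  by (rule has_derivative_eq_rhs) (simp_all add: fun_eq_iff field_simps)

lemma height_differentiable [simp]: "height differentiable (at q)"
  using has_derivative_height differentiable_def by blast

lemma partial_d_height [simp]: "partial_d i height q = q $ i / height q"
  using exhaust_2[of i] by (subst partial_d_eq[OF has_derivative_height]) (auto simp: axis_def)

lemma hparam_nth [simp]: "hparam q $ 1 = height q" "hparam q $ 2 = q $ 1" "hparam q $ 3 = q $ 2"
  by (simp_all add: hparam_def hsq_def)

lemma mink_dparam:
  "mink (dparam q a) (dparam q b)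
   = a $ 1 * b $ 1 + a $ 2 * b $ 2 - (q $ 1 * a $ 1 + q $ 2 * a $ 2) * (q $ 1 * b $ 1 + q $ 2 * b $ 2) / hsq q"
  by (simp add: mink_def dparam_eq less_imp_le)

lemma hmetric_nth: "hmetric q $ i $ j = of_bool (i = j) - q $ i * q $ j / hsq q"
  using exhaust_2[of i] exhaust_2[of j] by (auto simp: hmetric_def mink_dparam axis_def)

lemma matrix_inv_eqI:
  fixes A B :: "real^'n^'n::finite"
  assumes "A ** B = mat 1"
  shows "matrix_inv A = B"
proof -
  have BA: "B ** A = mat 1" using assms matrix_left_right_inverse by blast
  have "\<exists>A'. A ** A' = mat 1 \<and> A' ** A = mat 1" using assms BA by blast
  then have "A ** matrix_inv A = mat 1" unfolding matrix_inv_def by (rule someI2_ex) simp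
  then have "B ** A ** matrix_inv A = B ** mat 1" by (simp add: matrix_mul_assoc[symmetric])
  then show ?thesis using BA by simp
qed

lemma hmetric_mult_inverse:
  "(\<Sum>k\<in>UNIV. hmetric q $ i $ k * (of_bool (k = j) + q $ k * q $ j)) = of_bool (i = j)"
  using exhaust_2[of i] exhaust_2[of j]
  by (auto simp: sum_2 hmetric_nth field_simps) (simp_all add: hsq_def algebra_simps power2_eq_square)

lemma matrix_inv_hmetric: "matrix_inv (hmetric q) = (\<chi> i j. of_bool (i = j) + q $ i * q $ j)"
  by (rule matrix_inv_eqI)
    (simp add: vec_eq_iff matrix_matrix_mult_def hmetric_mult_inverse mat_def)

lemma partial_d_hmetric:
  "partial_d l (\<lambda>y. hmetric y $ i $ j) q
   = - (of_bool (i = l) * q $ j + of_bool (j = l) * q $ i) / hsq q + 2 * q $ i * q $ j * q $ l / (hsq q)\<^sup>2"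
  unfolding hmetric_nth
  by (simp add: partial_d_simps field_simps power2_eq_square)

text \<open>With all indices lowered the Christoffel symbols need only the derivatives of the metric;
  raising the last index amounts to applying the inverse metric to the radial vector \<open>q\<close>.\<close>

lemma christoffel_hmetric_lowered:
  "partial_d i (\<lambda>y. hmetric y $ j $ l) q + partial_d j (\<lambda>y. hmetric y $ i $ l) q
     - partial_d l (\<lambda>y. hmetric y $ i $ j) q = - 2 * hmetric q $ i $ j * q $ l / hsq q"
  unfolding partial_d_hmetric unfolding hmetric_nth
  by (cases "i = j"; cases "j = l"; cases "i = l"; simp add: field_simps power2_eq_square)

lemma inverse_metric_radial: "(\<Sum>l\<in>UNIV. (of_bool (k = l) + q $ k * q $ l) * q $ l) = hsq q * q $ k"
  using exhaust_2[of k] by (auto simp: sum_2 hsq_def algebra_simps power2_eq_square)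

text \<open>This is the Gauss formula of the hyperboloid: the second derivatives of the embedding are
  \<open>\<Gamma>\<^sup>k\<^sub>i\<^sub>j \<partial>\<^sub>k + g\<^sub>i\<^sub>j p\<close>, and their chart components vanish because the chart is linear.\<close>

lemma christoffel_hmetric: "christoffel hmetric q k i j = - (hmetric q $ i $ j * q $ k)"
proof -
  have "christoffel hmetric q k i j = - (hmetric q $ i $ j / hsq q)
      * (\<Sum>l\<in>UNIV. (of_bool (k = l) + q $ k * q $ l) * q $ l)"
    unfolding christoffel_def matrix_inv_hmetric christoffel_hmetric_lowered
    by (simp add: sum_2 field_simps)
  then show ?thesis by (simp add: inverse_metric_radial)
qed

lemma conn_H2_eq: "conn_H2 q \<xi> w = - (mink (dparam q \<xi>) (dparam q w)) *\<^sub>R q"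
  by (simp add: vec_eq_iff conn_H2_def sum_2 christoffel_hmetric hmetric_nth mink_dparam)
     (simp add: field_simps)

text \<open>The operator \<open>\<Delta> - 2\<close> in the chart. Its degree-one part comes from the trace \<open>- 2 q\<close> of the
  Christoffel symbols.\<close>

definition massive_laplacian :: "(real^2 \<Rightarrow> real) \<Rightarrow> real^2 \<Rightarrow> real" where
  "massive_laplacian f q =
     (\<Sum>i\<in>UNIV. \<Sum>j\<in>UNIV. (of_bool (i = j) + q $ i * q $ j) * partial_d i (partial_d j f) q)
     + 2 * (\<Sum>i\<in>UNIV. q $ i * partial_d i f q) - 2 * f q"

lemma trace_hmetric:
  "(1 + q $ 1 * q $ 1) * hmetric q $ 1 $ 1 + q $ 1 * q $ 2 * hmetric q $ 1 $ 2
   + (q $ 2 * q $ 1 * hmetric q $ 2 $ 1 + (1 + q $ 2 * q $ 2) * hmetric q $ 2 $ 2) = 2"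
proof -
  have h: "hsq q = 1 + q $ 1 * q $ 1 + q $ 2 * q $ 2" by (simp add: hsq_def power2_eq_square)
  show ?thesis
    by (simp add: hmetric_nth field_simps) (use h in algebra)
qed

lemma laplace_H2_eq:
  assumes "p \<in> H2"
  shows "laplace_H2 u p - 2 * u p = massive_laplacian (u \<circ> hparam) (hchart p)"
proof -
  let ?q = "hchart p" and ?f = "u \<circ> hparam"
  let ?s = "?q $ 1 * partial_d 1 ?f ?q + ?q $ 2 * partial_d 2 ?f ?q"
  show ?thesis
    using arg_cong[OF trace_hmetric[of ?q], of "\<lambda>t. t * ?s"]
    by (simp add: laplace_H2_def hess_H2_def matrix_inv_hmetric christoffel_hmetric sum_2
        massive_laplacian_def hparam_hchart[OF assms] algebra_simps)
qed

section \<open>The metric of the tangent bundle\<close>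

lemma sum_plus_UNIV:
  fixes f :: "'a::finite + 'b::finite \<Rightarrow> 'c::comm_monoid_add"
  shows "sum f UNIV = (\<Sum>i\<in>UNIV. f (Inl i)) + (\<Sum>i\<in>UNIV. f (Inr i))"
  unfolding UNIV_Plus_UNIV[symmetric] by (subst sum.Plus) simp_all

abbreviation base_hsq :: "real^(2+2) \<Rightarrow> real" where
  "base_hsq z \<equiv> hsq (base_part z)"

definition base_dot_fibre :: "real^(2+2) \<Rightarrow> real" where
  "base_dot_fibre z = z $ Inl 1 * z $ Inr 1 + z $ Inl 2 * z $ Inr 2"

lemma base_part_nth [simp]: "base_part z $ i = z $ Inl i" and fibre_part_nth [simp]: "fibre_part z $ i = z $ Inr i"
  by (simp_all add: base_part_def fibre_part_def)

text \<open>The block of \<open>GG_matrix\<close> in the base coordinates. It equals the derivative of the hyperbolic metric in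
  the direction of the fibre coordinate \<open>v\<close>, which is what makes \<open>GG\<close> the complete lift of the metric:
  in block form it is \<open>(v \<cdot> \<partial>g, g; g, 0)\<close>.\<close>

definition GG_base_block :: "real^(2+2) \<Rightarrow> 2 \<Rightarrow> 2 \<Rightarrow> real" where
  "GG_base_block z i j = - (z $ Inr i * z $ Inl j + z $ Inr j * z $ Inl i) / base_hsq z
     + 2 * z $ Inl i * z $ Inl j * base_dot_fibre z / (base_hsq z)\<^sup>2"

lemma base_part_axis [simp]: "base_part (axis (Inl i) 1) = axis i 1" "base_part (axis (Inr i) 1) = 0"
  and fibre_part_axis [simp]: "fibre_part (axis (Inl i) 1) = 0" "fibre_part (axis (Inr i) 1) = axis i 1"
  by (simp_all add: base_part_def fibre_part_def axis_def vec_eq_iff)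

lemma radial_metric:
  "mink (dparam q a) (dparam q q) = (q $ 1 * a $ 1 + q $ 2 * a $ 2) / hsq q"
  by (simp add: mink_dparam field_simps) (simp add: hsq_def algebra_simps power2_eq_square)

lemma mink_dparam_diff:
  "mink (dparam q a) (dparam q (b - c *\<^sub>R d)) = mink (dparam q a) (dparam q b) - c * mink (dparam q a) (dparam q d)"
  "mink (dparam q (b - c *\<^sub>R d)) (dparam q a) = mink (dparam q a) (dparam q b) - c * mink (dparam q a) (dparam q d)"
  by (simp_all add: mink_dparam field_simps)

lemma dparam_zero [simp]: "dparam q 0 = 0"
  by (simp add: dparam_eq vec_eq_iff forall_3)

lemma mink_zero [simp]: "mink 0 x = 0" "mink x 0 = 0"
  by (simp_all add: mink_def)

lemma GG_eq:
  fixes z X Y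
  defines "q \<equiv> base_part z" and "v \<equiv> fibre_part z"
  shows "GG z X Y = mink (dparam q (base_part X)) (dparam q (fibre_part Y))
     + mink (dparam q (base_part Y)) (dparam q (fibre_part X))
     - mink (dparam q (base_part Y)) (dparam q v) * (q $ 1 * base_part X $ 1 + q $ 2 * base_part X $ 2) / hsq q
     - mink (dparam q (base_part X)) (dparam q v) * (q $ 1 * base_part Y $ 1 + q $ 2 * base_part Y $ 2) / hsq q"
  unfolding GG_def hor_part_def ver_part_def conn_H2_eq q_def[symmetric] v_def[symmetric]
  by (simp add: mink_dparam_diff radial_metric del: base_part_nth)

lemma GG_matrix_nth:
  "GG_matrix z $ Inl i $ Inl j = GG_base_block z i j"
  "GG_matrix z $ Inl i $ Inr j = hmetric (base_part z) $ i $ j"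
  "GG_matrix z $ Inr i $ Inl j = hmetric (base_part z) $ i $ j"
  "GG_matrix z $ Inr i $ Inr j = 0"
  unfolding GG_matrix_def GG_base_block_def base_dot_fibre_def
  using exhaust_2[of i] exhaust_2[of j]
  by (auto simp: GG_eq mink_dparam hmetric_nth axis_def field_simps power2_eq_square)

text \<open>The fibre block is the derivative of the inverse metric \<open>\<delta>\<^sub>i\<^sub>j + q\<^sub>i q\<^sub>j\<close> in direction \<open>v\<close>, by the formula
  for the derivative of an inverse matrix.\<close>

definition GG_inverse :: "real^(2+2) \<Rightarrow> real^(2+2)^(2+2)" where
  "GG_inverse z = (\<chi> a b. case (a, b) of
     (Inl i, Inl j) \<Rightarrow> 0
   | (Inl i, Inr j) \<Rightarrow> of_bool (i = j) + z $ Inl i * z $ Inl j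
   | (Inr i, Inl j) \<Rightarrow> of_bool (i = j) + z $ Inl i * z $ Inl j
   | (Inr i, Inr j) \<Rightarrow> z $ Inl i * z $ Inr j + z $ Inr i * z $ Inl j)"

lemma hmetric_radial: "(\<Sum>k\<in>UNIV. hmetric q $ i $ k * q $ k) = q $ i / hsq q"
  using exhaust_2[of i]
  by (auto simp: sum_2 hmetric_nth field_simps) (simp_all add: hsq_def algebra_simps power2_eq_square)

lemma matrix_inv_GG: "matrix_inv (GG_matrix z) = GG_inverse z"
proof (rule matrix_inv_eqI)
  have "(GG_matrix z ** GG_inverse z) $ a $ b = mat 1 $ a $ b" for a b
  proof (cases a; cases b)
    fix i j assume ab: "a = Inl i" "b = Inl j"
    show ?thesis
      using hmetric_mult_inverse[of "base_part z" i j] ab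
      by (simp add: matrix_matrix_mult_def sum_plus_UNIV GG_matrix_nth GG_inverse_def mat_def)
  next
    fix i j assume ab: "a = Inr i" "b = Inl j"
    show ?thesis
      using ab by (simp add: matrix_matrix_mult_def sum_plus_UNIV GG_matrix_nth GG_inverse_def mat_def)
  next
    fix i j assume ab: "a = Inr i" "b = Inr j"
    show ?thesis
      using hmetric_mult_inverse[of "base_part z" i j] ab
      by (simp add: matrix_matrix_mult_def sum_plus_UNIV GG_matrix_nth GG_inverse_def mat_def)
  next
    fix i j assume ab: "a = Inl i" "b = Inr j"
    let ?q = "base_part z" and ?c = "\<lambda>k. of_bool (k = j) + z $ Inl k * z $ Inl j"
    define w where "w i = z $ Inr i - z $ Inl i * base_dot_fibre z / base_hsq z" for i
    have block: "GG_base_block z i k = - (w i * z $ Inl k + w k * z $ Inl i) / base_hsq z" for k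
      by (simp add: GG_base_block_def w_def field_simps power2_eq_square)
    have gv: "(\<Sum>k\<in>UNIV. hmetric ?q $ i $ k * z $ Inr k) = w i"
      using exhaust_2[of i] by (auto simp: w_def sum_2 hmetric_nth base_dot_fibre_def field_simps)
    have qc: "(\<Sum>k\<in>UNIV. z $ Inl k * ?c k) = base_hsq z * z $ Inl j"
      using inverse_metric_radial[of j ?q] exhaust_2[of j] by (auto simp: mult.commute sum_2)
    have qw: "z $ Inl 1 * w 1 + z $ Inl 2 * w 2 = base_dot_fibre z / base_hsq z"
      by (simp add: w_def base_dot_fibre_def field_simps) (simp add: hsq_def algebra_simps power2_eq_square)
    have "(\<Sum>k\<in>UNIV. w k * ?c k) = w j + z $ Inl j * (z $ Inl 1 * w 1 + z $ Inl 2 * w 2)"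
      using exhaust_2[of j] by (auto simp: sum_2 algebra_simps)
    then have wc: "(\<Sum>k\<in>UNIV. w k * ?c k) = z $ Inr j"
      unfolding qw by (simp add: w_def)
    have s1: "(\<Sum>k\<in>UNIV. GG_base_block z i k * ?c k)
        = - (w i * (\<Sum>k\<in>UNIV. z $ Inl k * ?c k) + z $ Inl i * (\<Sum>k\<in>UNIV. w k * ?c k)) / base_hsq z"
      unfolding block sum_2 by (simp add: field_simps)
    have s2: "(\<Sum>k\<in>UNIV. hmetric ?q $ i $ k * (z $ Inl k * z $ Inr j + z $ Inr k * z $ Inl j))
        = (\<Sum>k\<in>UNIV. hmetric ?q $ i $ k * ?q $ k) * z $ Inr j + (\<Sum>k\<in>UNIV. hmetric ?q $ i $ k * z $ Inr k) * z $ Inl j"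
      by (simp add: sum_2 algebra_simps)
    have "(\<Sum>k\<in>UNIV. GG_base_block z i k * ?c k)
        + (\<Sum>k\<in>UNIV. hmetric ?q $ i $ k * (z $ Inl k * z $ Inr j + z $ Inr k * z $ Inl j)) = 0"
      unfolding s1 s2 qc wc gv hmetric_radial by (simp add: field_simps)
    then show ?thesis
      using ab by (simp add: matrix_matrix_mult_def sum_plus_UNIV GG_matrix_nth GG_inverse_def mat_def)
  qed
  then show "GG_matrix z ** GG_inverse z = mat 1" by (simp add: vec_eq_iff)
qed

lemma base_hsq_differentiable [simp]: "base_hsq differentiable (at z)"
  and base_dot_fibre_differentiable [simp]: "base_dot_fibre differentiable (at z)"
  unfolding hsq_def base_dot_fibre_def[abs_def] by simp_all

lemma partial_d_base_hsq [simp]: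
  "partial_d (Inl i) base_hsq z = 2 * z $ Inl i" "partial_d (Inr i) base_hsq z = 0"
  using exhaust_2[of i] unfolding hsq_def by (auto simp: partial_d_simps)

lemma partial_d_base_dot_fibre [simp]:
  "partial_d (Inl i) base_dot_fibre z = z $ Inr i" "partial_d (Inr i) base_dot_fibre z = z $ Inl i"
  using exhaust_2[of i] unfolding base_dot_fibre_def[abs_def] by (auto simp: partial_d_simps)

lemma partial_d_hmetric_base:
  "partial_d (Inl l) (\<lambda>z. hmetric (base_part z) $ i $ j) z = partial_d l (\<lambda>y. hmetric y $ i $ j) (base_part z)"
  "partial_d (Inr l) (\<lambda>z. hmetric (base_part z) $ i $ j) z = 0"
  unfolding partial_d_hmetric unfolding hmetric_nth base_part_nth
  by (simp_all add: partial_d_simps field_simps power2_eq_square)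

text \<open>The quotient rule in a form that keeps the powers of the denominator apart, so that the identities
  below can be compared power by power without clearing denominators.\<close>

lemma partial_d_over_base_hsq:
  assumes "f differentiable (at z)"
  shows "partial_d a (\<lambda>z. f z / base_hsq z) z = partial_d a f z / base_hsq z - f z * partial_d a base_hsq z / (base_hsq z)\<^sup>2"
    and "partial_d a (\<lambda>z. f z / (base_hsq z)\<^sup>2) z = partial_d a f z / (base_hsq z)\<^sup>2 - 2 * f z * partial_d a base_hsq z / (base_hsq z) ^ 3"
  using assms by (simp_all add: partial_d_simps field_simps power2_eq_square power3_eq_cube)

lemma partial_d_GG_base_block:
  "partial_d (Inl l) (\<lambda>z. GG_base_block z i j) z =
     - (z $ Inr i * of_bool (j = l) + z $ Inr j * of_bool (i = l)) / base_hsq z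
     + 2 * z $ Inl l * (z $ Inr i * z $ Inl j + z $ Inr j * z $ Inl i) / (base_hsq z)\<^sup>2
     + 2 * (of_bool (i = l) * z $ Inl j + of_bool (j = l) * z $ Inl i) * base_dot_fibre z / (base_hsq z)\<^sup>2
     + 2 * z $ Inl i * z $ Inl j * z $ Inr l / (base_hsq z)\<^sup>2
     - 8 * z $ Inl i * z $ Inl j * z $ Inl l * base_dot_fibre z / (base_hsq z) ^ 3"
  "partial_d (Inr l) (\<lambda>z. GG_base_block z i j) z = partial_d l (\<lambda>y. hmetric y $ i $ j) (base_part z)"
  unfolding GG_base_block_def partial_d_hmetric
  by (simp_all add: partial_d_over_base_hsq partial_d_add partial_d_diff partial_d_minus partial_d_mult)
    (simp_all add: eq_commute[of l] add_divide_distrib diff_divide_distrib algebra_simps)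

text \<open>The derivative in direction \<open>v\<close> of the lowered symbols \<open>- g\<^sub>i\<^sub>j q\<^sub>l / x\<^sub>0\<^sup>2\<close>, doubled.\<close>

lemma GG_base_block_lowered:
  "partial_d (Inl i) (\<lambda>y. GG_base_block y j l) z + partial_d (Inl j) (\<lambda>y. GG_base_block y i l) z
     - partial_d (Inl l) (\<lambda>y. GG_base_block y i j) z
   = - 2 * (GG_base_block z i j * z $ Inl l + hmetric (base_part z) $ i $ j * z $ Inr l) / base_hsq z
     + 4 * hmetric (base_part z) $ i $ j * z $ Inl l * base_dot_fibre z / (base_hsq z)\<^sup>2"
  unfolding partial_d_GG_base_block unfolding hmetric_nth GG_base_block_def
  by (cases "i = j"; cases "j = l"; cases "i = l";
      simp add: add_divide_distrib diff_divide_distrib algebra_simps power2_eq_square power3_eq_cube)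

text \<open>For a complete lift the symbols with a fibre index on top are those of the base metric and, for two
  base indices below, their derivative in direction \<open>v\<close>; here \<open>\<Gamma>\<^sup>k\<^sub>i\<^sub>j = - g\<^sub>i\<^sub>j q\<^sub>k\<close>.\<close>

lemma christoffel_GG:
  "christoffel GG_matrix z (Inr k) (Inr i) (Inr j) = 0"
  "christoffel GG_matrix z (Inr k) (Inl i) (Inr j) = christoffel hmetric (base_part z) k i j"
  "christoffel GG_matrix z (Inr k) (Inr i) (Inl j) = christoffel hmetric (base_part z) k i j"
  "christoffel GG_matrix z (Inr k) (Inl i) (Inl j) =
     - (GG_base_block z i j * z $ Inl k + hmetric (base_part z) $ i $ j * z $ Inr k)"
proof -
  let ?q = "base_part z"
  show "christoffel GG_matrix z (Inr k) (Inr i) (Inr j) = 0"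
    by (simp add: christoffel_def matrix_inv_GG sum_plus_UNIV GG_matrix_nth partial_d_hmetric_base)
  show "christoffel GG_matrix z (Inr k) (Inl i) (Inr j) = christoffel hmetric ?q k i j"
    by (simp add: christoffel_def matrix_inv_GG sum_plus_UNIV GG_matrix_nth GG_inverse_def
        partial_d_hmetric_base partial_d_GG_base_block matrix_inv_hmetric)
  show "christoffel GG_matrix z (Inr k) (Inr i) (Inl j) = christoffel hmetric ?q k i j"
    by (simp add: christoffel_def matrix_inv_GG sum_plus_UNIV GG_matrix_nth GG_inverse_def
        partial_d_hmetric_base partial_d_GG_base_block matrix_inv_hmetric)
  have vert: "(\<Sum>l\<in>UNIV. (of_bool (k = l) + ?q $ k * ?q $ l) * z $ Inr l) = z $ Inr k + z $ Inl k * base_dot_fibre z"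
    using exhaust_2[of k] by (auto simp: sum_2 base_dot_fibre_def algebra_simps)
  have quad: "z $ Inl 1 * z $ Inl 1 + z $ Inl 2 * z $ Inl 2 = base_hsq z - 1"
    by (simp add: hsq_def power2_eq_square)
  have "christoffel GG_matrix z (Inr k) (Inl i) (Inl j) =
     - (GG_base_block z i j / base_hsq z) * (\<Sum>l\<in>UNIV. (of_bool (k = l) + ?q $ k * ?q $ l) * ?q $ l)
     - hmetric ?q $ i $ j / base_hsq z * (\<Sum>l\<in>UNIV. (of_bool (k = l) + ?q $ k * ?q $ l) * z $ Inr l)
     + 2 * hmetric ?q $ i $ j * base_dot_fibre z / (base_hsq z)\<^sup>2 * (\<Sum>l\<in>UNIV. (of_bool (k = l) + ?q $ k * ?q $ l) * ?q $ l)
     - hmetric ?q $ i $ j / base_hsq z * (z $ Inl k * base_dot_fibre z + z $ Inr k * (z $ Inl 1 * z $ Inl 1 + z $ Inl 2 * z $ Inl 2))"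
    unfolding christoffel_def matrix_inv_GG sum_plus_UNIV GG_matrix_nth partial_d_hmetric_base
      partial_d_GG_base_block(2) GG_base_block_lowered christoffel_hmetric_lowered
    by (simp add: sum_2 GG_inverse_def base_dot_fibre_def field_simps power2_eq_square)
  also have "\<dots> = - (GG_base_block z i j * z $ Inl k + hmetric ?q $ i $ j * z $ Inr k)"
    unfolding inverse_metric_radial vert quad by (simp add: field_simps power2_eq_square)
  finally show "christoffel GG_matrix z (Inr k) (Inl i) (Inl j) =
     - (GG_base_block z i j * z $ Inl k + hmetric ?q $ i $ j * z $ Inr k)" .
qed

lemma trace_GG_base_block:
  "(\<Sum>i\<in>UNIV. \<Sum>j\<in>UNIV. (of_bool (i = j) + z $ Inl i * z $ Inl j) * GG_base_block z i j) = - 2 * base_dot_fibre z / base_hsq z"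
proof -
  let ?q = "base_part z"
  have quad: "z $ Inl 1 * z $ Inl 1 + z $ Inl 2 * z $ Inl 2 = base_hsq z - 1"
    by (simp add: hsq_def power2_eq_square)
  have "(\<Sum>i\<in>UNIV. \<Sum>j\<in>UNIV. (of_bool (i = j) + z $ Inl i * z $ Inl j) * GG_base_block z i j)
    = - 2 * base_dot_fibre z / base_hsq z * (1 + (z $ Inl 1 * z $ Inl 1 + z $ Inl 2 * z $ Inl 2))
      + 2 * base_dot_fibre z / (base_hsq z)\<^sup>2 * ((z $ Inl 1 * z $ Inl 1 + z $ Inl 2 * z $ Inl 2)
        * (1 + (z $ Inl 1 * z $ Inl 1 + z $ Inl 2 * z $ Inl 2)))"
    unfolding GG_base_block_def sum_2
    by (simp add: base_dot_fibre_def add_divide_distrib diff_divide_distrib algebra_simps)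
  then show ?thesis unfolding quad by (simp add: field_simps power2_eq_square)
qed

lemma inverse_mult_hmetric:
  "(\<Sum>i\<in>UNIV. (of_bool (i = j) + q $ i * q $ j) * hmetric q $ i $ c) = of_bool (j = c)"
  using exhaust_2[of c] exhaust_2[of j]
  by (auto simp: sum_2 hmetric_nth field_simps) (simp_all add: hsq_def algebra_simps power2_eq_square)

lemma contract_metric:
  "(\<Sum>i\<in>UNIV. \<Sum>j\<in>UNIV. (of_bool (i = j) + q $ i * q $ j) * (\<Sum>c\<in>UNIV. hmetric q $ i $ c * D j c)) = (\<Sum>j\<in>UNIV. D j j)"
proof -
  have "(\<Sum>i\<in>UNIV. \<Sum>j\<in>UNIV. (of_bool (i = j) + q $ i * q $ j) * (\<Sum>c\<in>UNIV. hmetric q $ i $ c * D j c))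
     = (\<Sum>j\<in>UNIV. \<Sum>c\<in>UNIV. (\<Sum>i\<in>UNIV. (of_bool (i = j) + q $ i * q $ j) * hmetric q $ i $ c) * D j c)"
    by (simp add: sum_2 algebra_simps)
  then show ?thesis unfolding inverse_mult_hmetric by (simp add: sum_2)
qed

lemma hmetric_sym: "hmetric q $ i $ j = hmetric q $ j $ i"
  by (simp add: hmetric_nth eq_commute mult.commute)

section \<open>The tension field of a section\<close>

lemma section_map_nth [simp]:
  "section_map V y $ Inl i = y $ i" "section_map V y $ Inr i = vf_coords V y $ i"
  "base_part (section_map V y) = y" "fibre_part (section_map V y) = vf_coords V y"
proof -
  show "section_map V y $ Inl i = y $ i" "section_map V y $ Inr i = vf_coords V y $ i"
    by (simp_all add: section_map_def join_parts_def)
qed (simp_all only: section_map_def join_parts_simps)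

lemma second_cov_deriv_section:
  fixes V q
  defines "W \<equiv> \<lambda>k y. vf_coords V y $ k" and "g \<equiv> \<lambda>i j. hmetric q $ i $ j"
  assumes F: "section_map V differentiable (at q)"
  shows "second_cov_deriv hmetric GG_matrix (section_map V) q i j $ Inr k =
     partial_d i (partial_d j (W k)) q
     - (GG_base_block (section_map V q) i j * q $ k + g i j * W k q)
     - q $ k * (\<Sum>c\<in>UNIV. g i c * partial_d j (W c) q)
     - q $ k * (\<Sum>c\<in>UNIV. g c j * partial_d i (W c) q)
     + g i j * (\<Sum>m\<in>UNIV. q $ m * partial_d m (W k) q)"
proof -
  have "(\<Sum>b\<in>UNIV. \<Sum>c\<in>UNIV. christoffel GG_matrix (section_map V q) (Inr k) b c
          * partial_d i (\<lambda>y. section_map V y $ b) q * partial_d j (\<lambda>y. section_map V y $ c) q)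
     = - (GG_base_block (section_map V q) i j * q $ k + g i j * W k q)
     - q $ k * (\<Sum>c\<in>UNIV. g i c * partial_d j (W c) q)
     - q $ k * (\<Sum>c\<in>UNIV. g c j * partial_d i (W c) q)"
    using exhaust_2[of i] exhaust_2[of j]
    by (elim disjE; simp add: sum_plus_UNIV christoffel_GG christoffel_hmetric sum_2 W_def g_def algebra_simps)
  moreover have "partial_d m (section_map V) q $ Inr k = partial_d m (W k) q" for m
    using partial_d_component[OF F, of m "Inr k"] by (simp add: W_def)
  ultimately show ?thesis
    by (simp add: second_cov_deriv_def christoffel_hmetric sum_negf g_def[symmetric] W_def[symmetric])
       (simp add: sum_2 algebra_simps W_def g_def)
qed

text \<open>The contraction of \<open>second_cov_deriv_section\<close> with the inverse metric. The zeroth-order term \<open>- 2 W\<close>, the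
  trace of \<open>g\<^sub>i\<^sub>j W\<^sub>k\<close>, is the mass term of the operator. The bracket is \<open>- div W\<close> for the divergence
  of the hyperbolic metric, whose volume density is \<open>1 / x\<^sub>0\<close>.\<close>

lemma tension_field_section:
  fixes V q
  defines "W \<equiv> \<lambda>k y. vf_coords V y $ k"
  assumes F: "section_map V differentiable (at q)"
  shows "tension_field hmetric GG_matrix (section_map V) q $ Inr k = massive_laplacian (W k) q
     + 2 * q $ k * ((q $ 1 * W 1 q + q $ 2 * W 2 q) / hsq q - (\<Sum>m\<in>UNIV. partial_d m (W m) q))"
proof -
  let ?G = "\<lambda>i j. of_bool (i = j) + q $ i * q $ j" and ?g = "\<lambda>i j. hmetric q $ i $ j"
  let ?A = "\<lambda>i j. GG_base_block (section_map V q) i j"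
  have A: "(\<Sum>i\<in>UNIV. \<Sum>j\<in>UNIV. ?G i j * ?A i j) = - 2 * (q $ 1 * W 1 q + q $ 2 * W 2 q) / hsq q"
    using trace_GG_base_block[of "section_map V q"] by (simp add: base_dot_fibre_def W_def)
  have g: "(\<Sum>i\<in>UNIV. \<Sum>j\<in>UNIV. ?G i j * ?g i j) = 2"
    using trace_hmetric[of q] by (simp add: sum_2)
  have c1: "(\<Sum>i\<in>UNIV. \<Sum>j\<in>UNIV. ?G i j * (\<Sum>c\<in>UNIV. ?g i c * partial_d j (W c) q)) = (\<Sum>m\<in>UNIV. partial_d m (W m) q)"
    by (rule contract_metric)
  have c2: "(\<Sum>i\<in>UNIV. \<Sum>j\<in>UNIV. ?G i j * (\<Sum>c\<in>UNIV. ?g c j * partial_d i (W c) q)) = (\<Sum>m\<in>UNIV. partial_d m (W m) q)"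
    using c1 by (simp add: sum_2 algebra_simps hmetric_sym[of q 2 1])
  have "tension_field hmetric GG_matrix (section_map V) q $ Inr k =
     (\<Sum>i\<in>UNIV. \<Sum>j\<in>UNIV. ?G i j * second_cov_deriv hmetric GG_matrix (section_map V) q i j $ Inr k)"
    by (simp add: tension_field_def matrix_inv_hmetric)
  also have "\<dots> = (\<Sum>i\<in>UNIV. \<Sum>j\<in>UNIV. ?G i j * partial_d i (partial_d j (W k)) q)
      - q $ k * (\<Sum>i\<in>UNIV. \<Sum>j\<in>UNIV. ?G i j * ?A i j)
      - W k q * (\<Sum>i\<in>UNIV. \<Sum>j\<in>UNIV. ?G i j * ?g i j)
      - q $ k * (\<Sum>i\<in>UNIV. \<Sum>j\<in>UNIV. ?G i j * (\<Sum>c\<in>UNIV. ?g i c * partial_d j (W c) q))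
      - q $ k * (\<Sum>i\<in>UNIV. \<Sum>j\<in>UNIV. ?G i j * (\<Sum>c\<in>UNIV. ?g c j * partial_d i (W c) q))
      + (\<Sum>m\<in>UNIV. q $ m * partial_d m (W k) q) * (\<Sum>i\<in>UNIV. \<Sum>j\<in>UNIV. ?G i j * ?g i j)"
    unfolding second_cov_deriv_section[OF F] W_def
    by (simp add: sum_2) (simp add: algebra_simps)
  also have "\<dots> = massive_laplacian (W k) q
     + 2 * q $ k * ((q $ 1 * W 1 q + q $ 2 * W 2 q) / hsq q - (\<Sum>m\<in>UNIV. partial_d m (W m) q))"
    unfolding A g c1 c2 massive_laplacian_def by (simp add: algebra_simps add_divide_distrib diff_divide_distrib)
  finally show ?thesis .
qed

section \<open>The potential of a harmonic Lagrangian field\<close>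

lemma partial_d_partial_d_height_mult:
  assumes g: "smooth_fun g"
  shows "partial_d i (partial_d j (\<lambda>q. height q * g q)) q =
    (of_bool (i = j) / height q - q $ i * q $ j / height q ^ 3) * g q
     + (q $ j * partial_d i g q + q $ i * partial_d j g q) / height q + height q * partial_d i (partial_d j g) q"
proof -
  have d: "g differentiable (at x)" "partial_d j g differentiable (at x)" for x
    using g by (auto intro: smooth_fun_differentiable smooth_fun_partial_d)
  have cancel: "(a * h - b * (c / h)) / h\<^sup>2 = a / h - c * b / h ^ 3" if "h \<noteq> 0" for a b c h :: real
    using that by (simp add: field_simps power2_eq_square power3_eq_cube)
  have h: "height q \<noteq> 0" by simp
  have slope: "partial_d i (\<lambda>q. q $ j / height q) q = of_bool (i = j) / height q - q $ i * q $ j / height q ^ 3"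
    unfolding partial_d_divide[OF differentiable_vec_nth height_differentiable h] partial_d_vec_nth partial_d_height
    by (rule cancel[OF h])
  have "partial_d j (\<lambda>q. height q * g q) = (\<lambda>q. q $ j / height q * g q + height q * partial_d j g q)"
    by (simp add: fun_eq_iff partial_d_mult d)
  moreover have "partial_d i (\<lambda>q. q $ j / height q * g q + height q * partial_d j g q) q =
     partial_d i (\<lambda>q. q $ j / height q) q * g q + q $ j / height q * partial_d i g q
     + (q $ i / height q * partial_d j g q + height q * partial_d i (partial_d j g) q)"
    using partial_d_mult[of "\<lambda>q. q $ j / height q" q g i] by (simp add: partial_d_add partial_d_mult d)
  ultimately show ?thesis
    unfolding slope by (simp add: add_divide_distrib)
qed

text \<open>The height itself is annihilated by the operator, so no multiple of \<open>g\<close> survives.\<close>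

lemma massive_laplacian_height_mult:
  assumes g: "smooth_fun g"
  shows "massive_laplacian (\<lambda>q. height q * g q) q = height q *
    ((\<Sum>i\<in>UNIV. \<Sum>j\<in>UNIV. (of_bool (i = j) + q $ i * q $ j) * partial_d i (partial_d j g) q)
      + 4 * (\<Sum>i\<in>UNIV. q $ i * partial_d i g q))"
proof -
  let ?h = "height q" and ?n = "q $ 1 * q $ 1 + q $ 2 * q $ 2"
  have d: "g differentiable (at q)" using g by (rule smooth_fun_differentiable)
  have first: "partial_d i (\<lambda>q. height q * g q) q = q $ i / ?h * g q + ?h * partial_d i g q" for i
    by (simp add: partial_d_mult d)
  have n: "?n = ?h\<^sup>2 - 1" by (simp add: hsq_def power2_eq_square less_imp_le)
  have h: "?h \<noteq> 0" by simp
  have "massive_laplacian (\<lambda>q. height q * g q) q =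
     g q * ((2 + ?n) / ?h - ?n * (1 + ?n) / ?h ^ 3 + 2 * ?n / ?h - 2 * ?h)
     + 2 * (\<Sum>i\<in>UNIV. q $ i * partial_d i g q) * (1 + ?n) / ?h
     + ?h * (\<Sum>i\<in>UNIV. \<Sum>j\<in>UNIV. (of_bool (i = j) + q $ i * q $ j) * partial_d i (partial_d j g) q)
     + 2 * ?h * (\<Sum>i\<in>UNIV. q $ i * partial_d i g q)"
    unfolding massive_laplacian_def partial_d_partial_d_height_mult[OF g] first sum_2
    by (simp add: add_divide_distrib diff_divide_distrib algebra_simps)
  also have "\<dots> = ?h * ((\<Sum>i\<in>UNIV. \<Sum>j\<in>UNIV. (of_bool (i = j) + q $ i * q $ j) * partial_d i (partial_d j g) q)
      + 4 * (\<Sum>i\<in>UNIV. q $ i * partial_d i g q))"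
  proof -
    have "(2 + (h\<^sup>2 - 1)) / h - (h\<^sup>2 - 1) * (1 + (h\<^sup>2 - 1)) / h ^ 3 + 2 * (h\<^sup>2 - 1) / h - 2 * h = 0"
      "2 * s * (1 + (h\<^sup>2 - 1)) / h = 2 * h * s" if "h \<noteq> 0" for h s :: real
      using that by (simp_all add: field_simps power2_eq_square power3_eq_cube)
    from this[OF h] have "(2 + ?n) / ?h - ?n * (1 + ?n) / ?h ^ 3 + 2 * ?n / ?h - 2 * ?h = 0"
      "2 * s * (1 + ?n) / ?h = 2 * ?h * s" for s
      unfolding n by blast+
    then show ?thesis by (simp only:) (simp add: algebra_simps)
  qed
  finally show ?thesis .
qed

lemma massive_laplacian_differentiable:
  assumes "smooth_fun f"
  shows "massive_laplacian f differentiable (at q)"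
proof -
  have "f differentiable (at x)" "partial_d i f differentiable (at x)" "partial_d i (partial_d j f) differentiable (at x)" for i j x
    using assms by (auto intro: smooth_fun_differentiable smooth_fun_partial_d)
  then show ?thesis unfolding massive_laplacian_def[abs_def] sum_2 by simp
qed

text \<open>Third derivatives may be taken in any order, so \<open>\<partial>\<^sub>k\<close> reaches \<open>f\<close> at the cost of differentiating the
  coefficients; the resulting operator on \<open>\<partial>\<^sub>k f\<close> is the one in \<open>massive_laplacian_height_mult\<close>.\<close>

lemma partial_d_massive_laplacian:
  assumes f: "smooth_fun f"
  shows "partial_d k (massive_laplacian f) q =
    (\<Sum>i\<in>UNIV. \<Sum>j\<in>UNIV. (of_bool (i = j) + q $ i * q $ j) * partial_d i (partial_d j (partial_d k f)) q)
      + 4 * (\<Sum>i\<in>UNIV. q $ i * partial_d i (partial_d k f) q)"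
proof -
  have sm: "smooth_fun (partial_d i f)" "smooth_fun (partial_d i (partial_d j f))" for i j
    using f by (auto intro: smooth_fun_partial_d)
  have d: "f differentiable (at x)" "partial_d i f differentiable (at x)" "partial_d i (partial_d j f) differentiable (at x)" for i j x
    using f sm by (auto intro: smooth_fun_differentiable)
  have c: "partial_d i (partial_d j f) = partial_d j (partial_d i f)" for i j
    using partial_d_commute[OF f] by blast
  have "partial_d i (partial_d j (partial_d k f)) = partial_d k (partial_d i (partial_d j f))" for i j
    unfolding c[of j k] using partial_d_commute[OF sm(1)] by blast
  then have "(\<Sum>i\<in>UNIV. \<Sum>j\<in>UNIV. (of_bool (i = j) + q $ i * q $ j) * partial_d i (partial_d j (partial_d k f)) q)
      + 4 * (\<Sum>i\<in>UNIV. q $ i * partial_d i (partial_d k f) q)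
    = (\<Sum>i\<in>UNIV. \<Sum>j\<in>UNIV. (of_bool (i = j) + q $ i * q $ j) * partial_d k (partial_d i (partial_d j f)) q)
      + 4 * (\<Sum>i\<in>UNIV. q $ i * partial_d k (partial_d i f) q)"
    by (simp add: c[of _ k])
  then show ?thesis
    using exhaust_2[of k] unfolding massive_laplacian_def[abs_def] sum_2
    by (auto simp: partial_d_add partial_d_diff partial_d_mult d c[of 2 1] algebra_simps)
qed

text \<open>The field is divergence-free, being a rotated gradient, so the bracket in \<open>tension_field_section\<close>
  vanishes and harmonicity says that \<open>x\<^sub>0 \<partial>\<^sub>k f\<close> is annihilated by \<open>\<Delta> - 2\<close>. The lemmas
  \<open>massive_laplacian_height_mult\<close> and \<open>partial_d_massive_laplacian\<close> together express that the boost
  \<open>x\<^sub>0 \<partial>\<^sub>k\<close> commutes with this operator.\<close>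

lemma massive_laplacian_eq_const:
  assumes f: "smooth_fun f" and harm: "harmonic_map hmetric GG_matrix (section_map V)"
    and V: "\<And>q. vf_coords V q = vector [- (height q * partial_d 2 f q), height q * partial_d 1 f q]"
  shows "\<exists>k. \<forall>q. massive_laplacian f q = k"
proof -
  have sm: "smooth_fun (partial_d i f)" for i using f by (rule smooth_fun_partial_d)
  have d: "partial_d i f differentiable (at x)" for i x using sm by (rule smooth_fun_differentiable)
  have F: "section_map V differentiable (at q)" for q
    using harm by (auto simp: harmonic_map_def intro: smooth_fun_differentiable)
  have W: "(\<lambda>y. vf_coords V y $ 1) = (\<lambda>q. - (height q * partial_d 2 f q))"
    "(\<lambda>y. vf_coords V y $ 2) = (\<lambda>q. height q * partial_d 1 f q)"
    by (simp_all add: V)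
  have neg: "massive_laplacian (\<lambda>q. - (height q * partial_d 2 f q)) q = - massive_laplacian (\<lambda>q. height q * partial_d 2 f q) q" for q
  proof -
    have d1: "(\<lambda>q. height q * partial_d 2 f q) differentiable (at x)" for x by (simp add: d)
    have e1: "partial_d j (\<lambda>q. - (height q * partial_d 2 f q)) = (\<lambda>q. - partial_d j (\<lambda>q. height q * partial_d 2 f q) q)" for j
      by (rule ext) (rule partial_d_minus[OF d1])
    have "partial_d j (\<lambda>q. height q * partial_d 2 f q) = (\<lambda>q. q $ j / height q * partial_d 2 f q + height q * partial_d j (partial_d 2 f) q)" for j
      by (simp add: fun_eq_iff partial_d_mult d)
    moreover have "partial_d j (partial_d 2 f) differentiable (at x)" for j x
      using sm by (auto intro: smooth_fun_differentiable smooth_fun_partial_d)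
    ultimately have d2: "partial_d j (\<lambda>q. height q * partial_d 2 f q) differentiable (at x)" for j x
      by (simp add: d)
    show ?thesis
      unfolding massive_laplacian_def e1 partial_d_minus[OF d2] by (simp add: sum_2 algebra_simps)
  qed
  have bracket: "(q $ 1 * vf_coords V q $ 1 + q $ 2 * vf_coords V q $ 2) / hsq q
      = (\<Sum>m\<in>UNIV. partial_d m (\<lambda>y. vf_coords V y $ m) q)" for q
  proof -
    have "(\<Sum>m\<in>UNIV. partial_d m (\<lambda>y. vf_coords V y $ m) q)
       = (q $ 2 * partial_d 1 f q - q $ 1 * partial_d 2 f q) / height q"
      unfolding sum_2 W using partial_d_commute[OF f, of 1 2 q]
      by (simp add: partial_d_minus partial_d_mult d diff_divide_distrib)
    also have "\<dots> = (q $ 1 * vf_coords V q $ 1 + q $ 2 * vf_coords V q $ 2) / (height q * height q)"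
      by (simp add: V field_simps del: real_sqrt_mult_self)
    finally show ?thesis by (simp add: less_imp_le)
  qed
  have "massive_laplacian (\<lambda>y. vf_coords V y $ k) q = 0" for k q
    using tension_field_section[OF F, of q k] harm bracket[of q] by (simp add: harmonic_map_def)
  from this[of 1] this[of 2]
  have "massive_laplacian (\<lambda>q. height q * partial_d i f q) q = 0" for i q
    using exhaust_2[of i] unfolding W neg by auto
  then have "partial_d i (massive_laplacian f) q = 0" for i q
    unfolding massive_laplacian_height_mult[OF sm] partial_d_massive_laplacian[OF f] by simp
  then have "(massive_laplacian f has_derivative (\<lambda>h. 0)) (at q within UNIV)" for q
    using has_derivative_partial_d[OF massive_laplacian_differentiable[OF f, of q]] by simp
  then show ?thesis
    using has_derivative_zero_constant[of UNIV "massive_laplacian f"] by auto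
qed

section \<open>The Klein model\<close>

text \<open>The chart coordinates of the point of the hyperboloid over a point of the Klein disk.\<close>

definition klein_coords :: "complex \<Rightarrow> real^2" where
  "klein_coords \<eta> = vector [Re \<eta> / sqrt (1 - (cmod \<eta>)\<^sup>2), Im \<eta> / sqrt (1 - (cmod \<eta>)\<^sup>2)]"

lemma klein_coords_nth [simp]:
  "klein_coords \<eta> $ 1 = Re \<eta> / sqrt (1 - (cmod \<eta>)\<^sup>2)" "klein_coords \<eta> $ 2 = Im \<eta> / sqrt (1 - (cmod \<eta>)\<^sup>2)"
  by (simp_all add: klein_coords_def)

lemma ball_pos: "\<eta> \<in> ball (0::complex) 1 \<Longrightarrow> 1 - (cmod \<eta>)\<^sup>2 > 0"
  by (simp add: power_less_one_iff abs_square_less_1)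

lemma height_klein_coords:
  assumes "\<eta> \<in> ball 0 1"
  shows "height (klein_coords \<eta>) = 1 / sqrt (1 - (cmod \<eta>)\<^sup>2)"
proof -
  have "hsq (klein_coords \<eta>) = 1 / (1 - (cmod \<eta>)\<^sup>2)"
    using ball_pos[OF assms] by (simp add: hsq_def power_divide cmod_power2 field_simps)
  then show ?thesis by (simp add: real_sqrt_divide)
qed

lemma Klein_hparam: "Klein (hparam q) = Complex (q $ 1 / height q) (q $ 2 / height q)"
  by (simp add: Klein_def)

lemma cmod_Klein_hparam: "1 - (cmod (Klein (hparam q)))\<^sup>2 = 1 / hsq q"
  by (simp add: Klein_hparam cmod_power2 power_divide less_imp_le field_simps) (simp add: hsq_def)

lemma Klein_hparam_in_ball: "Klein (hparam q) \<in> ball 0 1"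
proof -
  have "1 - (cmod (Klein (hparam q)))\<^sup>2 > 0" unfolding cmod_Klein_hparam by simp
  then show ?thesis by (simp add: abs_square_less_1)
qed

lemma klein_coords_Klein: "klein_coords (Klein (hparam q)) = q"
  by (simp add: vec_eq_iff forall_2 cmod_Klein_hparam real_sqrt_divide) (simp add: Klein_hparam)

lemma Klein_klein_coords: "\<eta> \<in> ball 0 1 \<Longrightarrow> Klein (hparam (klein_coords \<eta>)) = \<eta>"
  using ball_pos[of \<eta>] by (simp add: Klein_hparam height_klein_coords complex_eq_iff)

lemma inj_on_Klein: "inj_on Klein H2"
  by (rule inj_on_inverseI[of _ "hparam \<circ> klein_coords"])
    (metis comp_apply hparam_hchart klein_coords_Klein)

lemma inv_into_Klein: "\<eta> \<in> ball 0 1 \<Longrightarrow> inv_into H2 Klein \<eta> = hparam (klein_coords \<eta>)"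
  by (rule inv_into_f_eq[OF inj_on_Klein hparam_in_H2 Klein_klein_coords])

lemma ubar_eq: "\<eta> \<in> ball 0 1 \<Longrightarrow> ubar u \<eta> = sqrt (1 - (cmod \<eta>)\<^sup>2) * (u \<circ> hparam) (klein_coords \<eta>)"
  by (simp add: ubar_def inv_into_Klein)

lemma ubar_Klein: "ubar u (Klein (hparam q)) = u (hparam q) / height q"
  using ubar_eq[OF Klein_hparam_in_ball, of u q]
  by (simp add: klein_coords_Klein cmod_Klein_hparam real_sqrt_divide)

text \<open>The Euclidean gradient of \<open>ubar u\<close>, as a complex number and as a function on the chart. It consists of the
  spatial coordinates of \<open>\<sigma>\<^sub>p = grad u - u p\<close>.\<close>

definition klein_grad :: "(real^2 \<Rightarrow> real) \<Rightarrow> real^2 \<Rightarrow> complex" where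
  "klein_grad f q = (let E = q $ 1 * partial_d 1 f q + q $ 2 * partial_d 2 f q - f q in
     Complex (partial_d 1 f q + E * q $ 1) (partial_d 2 f q + E * q $ 2))"

lemma klein_grad_sel [simp]:
  "Re (klein_grad f q) = partial_d 1 f q + (q $ 1 * partial_d 1 f q + q $ 2 * partial_d 2 f q - f q) * q $ 1"
  "Im (klein_grad f q) = partial_d 2 f q + (q $ 1 * partial_d 1 f q + q $ 2 * partial_d 2 f q - f q) * q $ 2"
  by (simp_all add: klein_grad_def Let_def)

lemma klein_coords_has_derivative:
  fixes \<eta>
  defines "s \<equiv> sqrt (1 - (cmod \<eta>)\<^sup>2)"
  assumes "\<eta> \<in> ball 0 1"
  shows "((\<lambda>\<eta>. sqrt (1 - (cmod \<eta>)\<^sup>2)) has_derivative (\<lambda>\<zeta>. - (\<eta> \<bullet> \<zeta>) / s)) (at \<eta>)"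
    and "(klein_coords has_derivative
      (\<lambda>\<zeta>. vector [Re \<zeta> / s + Re \<eta> * (\<eta> \<bullet> \<zeta>) / s ^ 3, Im \<zeta> / s + Im \<eta> * (\<eta> \<bullet> \<zeta>) / s ^ 3])) (at \<eta>)"
proof -
  have pos: "1 - (cmod \<eta>)\<^sup>2 > 0" using ball_pos[OF assms(2)] .
  then have s: "s > 0" "s \<noteq> 0" by (simp_all add: s_def)
  have sq: "((\<lambda>\<eta>. 1 - (cmod \<eta>)\<^sup>2) has_derivative (\<lambda>\<zeta>. - 2 * (\<eta> \<bullet> \<zeta>))) (at \<eta>)"
    unfolding cmod_power2
    by (auto intro!: derivative_eq_intros simp: inner_complex_def)
  show root: "((\<lambda>\<eta>. sqrt (1 - (cmod \<eta>)\<^sup>2)) has_derivative (\<lambda>\<zeta>. - (\<eta> \<bullet> \<zeta>) / s)) (at \<eta>)"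
    using DERIV_compose_FDERIV[OF DERIV_real_sqrt[OF pos] sq]
    by (rule has_derivative_eq_rhs) (simp add: fun_eq_iff s_def field_simps)
  have comp: "((\<lambda>\<eta>. X \<eta> / sqrt (1 - (cmod \<eta>)\<^sup>2)) has_derivative (\<lambda>\<zeta>. X \<zeta> / s + X \<eta> * (\<eta> \<bullet> \<zeta>) / s ^ 3)) (at \<eta>)"
    if X: "(X has_derivative X) (at \<eta>)" for X :: "complex \<Rightarrow> real"
    using has_derivative_divide'[OF X root s(2)[unfolded s_def]] unfolding s_def[symmetric]
    by (rule has_derivative_eq_rhs) (use s in \<open>simp add: fun_eq_iff field_simps power2_eq_square power3_eq_cube\<close>)
  have "(Re has_derivative Re) (at \<eta>)" "(Im has_derivative Im) (at \<eta>)"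
    by (auto intro: bounded_linear_imp_has_derivative bounded_linear_Re bounded_linear_Im)
  note c = comp[OF this(1)] comp[OF this(2)]
  have "((\<lambda>\<eta>. klein_coords \<eta> $ i) has_derivative
      (\<lambda>\<zeta>. vector [Re \<zeta> / s + Re \<eta> * (\<eta> \<bullet> \<zeta>) / s ^ 3, Im \<zeta> / s + Im \<eta> * (\<eta> \<bullet> \<zeta>) / s ^ 3] $ i)) (at \<eta>)" for i
    using exhaust_2[of i] c by (elim disjE) simp_all
  then show "(klein_coords has_derivative
      (\<lambda>\<zeta>. vector [Re \<zeta> / s + Re \<eta> * (\<eta> \<bullet> \<zeta>) / s ^ 3, Im \<zeta> / s + Im \<eta> * (\<eta> \<bullet> \<zeta>) / s ^ 3])) (at \<eta>)"
    by (subst has_derivative_componentwise_within) (auto simp: Basis_vec_def inner_axis)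
qed

lemma ubar_has_derivative:
  assumes u: "smooth_H2 u" and \<eta>: "\<eta> \<in> ball 0 1"
  shows "(ubar u has_derivative (\<lambda>\<zeta>. klein_grad (u \<circ> hparam) (klein_coords \<eta>) \<bullet> \<zeta>)) (at \<eta>)"
proof -
  let ?f = "u \<circ> hparam" and ?q = "klein_coords \<eta>"
  define s where "s = sqrt (1 - (cmod \<eta>)\<^sup>2)"
  have s: "s \<noteq> 0" using ball_pos[OF \<eta>] by (simp add: s_def)
  have q: "?q $ 1 = Re \<eta> / s" "?q $ 2 = Im \<eta> / s" by (simp_all add: s_def)
  have "?f differentiable (at ?q)" using u by (simp add: smooth_H2_def smooth_fun_differentiable)
  note df = has_derivative_compose[OF klein_coords_has_derivative(2)[OF \<eta>] has_derivative_partial_d[OF this]]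
  have "((\<lambda>\<eta>. sqrt (1 - (cmod \<eta>)\<^sup>2) * ?f (klein_coords \<eta>)) has_derivative
      (\<lambda>\<zeta>. klein_grad ?f ?q \<bullet> \<zeta>)) (at \<eta>)"
    using has_derivative_mult[OF klein_coords_has_derivative(1)[OF \<eta>] df] unfolding s_def[symmetric]
    by (rule has_derivative_eq_rhs)
      (use s in \<open>simp add: fun_eq_iff inner_complex_def q field_simps power2_eq_square power3_eq_cube del: klein_coords_nth\<close>)
  then show ?thesis
    by (rule has_derivative_transform_within_open[of _ _ _ _ "ball 0 1"]) (use \<eta> ubar_eq in auto)
qed

lemma frechet_derivative_ubar:
  "smooth_H2 u \<Longrightarrow> \<eta> \<in> ball 0 1 \<Longrightarrow>
    frechet_derivative (ubar u) (at \<eta>) = (\<lambda>\<zeta>. klein_grad (u \<circ> hparam) (klein_coords \<eta>) \<bullet> \<zeta>)"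
  using frechet_derivative_at[OF ubar_has_derivative] by metis

section \<open>The vector field of a graph\<close>

lemma mcross_eq:
  "x \<boxtimes> y = vector [- (x$2 * y$3 - x$3 * y$2), x$3 * y$1 - x$1 * y$3, x$1 * y$2 - x$2 * y$1]"
  by (rule mink_left_eqI, unfold mink_mcross) (simp add: mink_def det_3 algebra_simps)

text \<open>An affine function on the disk is determined by its values at \<open>0\<close>, \<open>1/2\<close> and \<open>\<i>/2\<close>.\<close>

lemma dual_plane_inj: "dual_plane \<sigma> = dual_plane \<tau> \<Longrightarrow> \<sigma> = \<tau>"
proof -
  assume eq: "dual_plane \<sigma> = dual_plane \<tau>"
  have *: "mink (vector [1, Re \<zeta>, Im \<zeta>]) \<sigma> = mink (vector [1, Re \<zeta>, Im \<zeta>]) \<tau>" if "\<zeta> \<in> ball 0 1" for \<zeta>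
  proof -
    have "(\<zeta>, mink (vector [1, Re \<zeta>, Im \<zeta>]) \<sigma>) \<in> dual_plane \<tau>"
      unfolding eq[symmetric] using that by (simp add: dual_plane_def)
    then show ?thesis by (simp add: dual_plane_def)
  qed
  show ?thesis
    using *[of 0] *[of "Complex (1/2) 0"] *[of "Complex 0 (1/2)"]
    by (simp add: mink_def vec_eq_iff forall_3 cmod_def power2_eq_square)
qed

lemma tangent_plane_ubar:
  assumes u: "smooth_H2 u"
  defines "f \<equiv> u \<circ> hparam"
  shows "tangent_plane (ubar u) (Klein (hparam q)) =
    dual_plane (vector [height q * (q $ 1 * partial_d 1 f q + q $ 2 * partial_d 2 f q - f q),
      Re (klein_grad f q), Im (klein_grad f q)])"
proof -
  let ?E = "q $ 1 * partial_d 1 f q + q $ 2 * partial_d 2 f q - f q" and ?\<eta> = "Klein (hparam q)"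
  have h: "height q \<noteq> 0" "1 + q $ 1 * q $ 1 + q $ 2 * q $ 2 = height q * height q"
    by (simp, simp add: hsq_def power2_eq_square)
  have cancel: "a * (b * b) / b = b * a" if "b \<noteq> 0" for a b :: real using that by simp
  have "klein_grad f q \<bullet> ?\<eta> - ubar u ?\<eta> = ?E * (1 + q $ 1 * q $ 1 + q $ 2 * q $ 2) / height q"
    unfolding ubar_Klein by (simp add: Klein_hparam inner_complex_def f_def add_divide_distrib diff_divide_distrib algebra_simps)
  also have "\<dots> = height q * ?E" unfolding h(2) by (rule cancel[OF h(1)])
  finally have "ubar u ?\<eta> + klein_grad f q \<bullet> (\<zeta> - ?\<eta>) = klein_grad f q \<bullet> \<zeta> - height q * ?E" for \<zeta>
    by (simp add: inner_diff_right)
  then show ?thesis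
    unfolding tangent_plane_def dual_plane_def frechet_derivative_ubar[OF u Klein_hparam_in_ball]
      klein_coords_Klein f_def[symmetric]
    by (auto simp: mink_def inner_complex_def algebra_simps)
qed

lemma V_gr_hparam:
  assumes u: "smooth_H2 u"
  defines "f \<equiv> u \<circ> hparam"
  shows "V_gr u (hparam q) = dparam q (vector [- (height q * partial_d 2 f q), height q * partial_d 1 f q])"
proof -
  have plane: "(THE \<sigma>. dual_plane \<sigma> = tangent_plane (ubar u) (Klein (hparam q))) =
    vector [height q * (q $ 1 * partial_d 1 f q + q $ 2 * partial_d 2 f q - f q),
      Re (klein_grad f q), Im (klein_grad f q)]"
    unfolding tangent_plane_ubar[OF u] f_def[symmetric]
    by (rule the_equality) (auto dest: dual_plane_inj)
  show ?thesis
    unfolding V_gr_def plane mcross_eq by (simp add: dparam_eq vec_eq_iff forall_3 field_simps)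
qed

lemma vf_coords_V_gr:
  "smooth_H2 u \<Longrightarrow> vf_coords (V_gr u) q = vector [- (height q * partial_d 2 (u \<circ> hparam) q), height q * partial_d 1 (u \<circ> hparam) q]"
  by (simp add: vf_coords_def V_gr_hparam hchart_dparam)

lemma Klein_has_derivative:
  assumes "p $ 1 \<noteq> 0"
  shows "(Klein has_derivative (\<lambda>w. Complex ((w $ 2 * p $ 1 - p $ 2 * w $ 1) / (p $ 1)\<^sup>2)
    ((w $ 3 * p $ 1 - p $ 3 * w $ 1) / (p $ 1)\<^sup>2))) (at p)"
proof -
  have "((\<lambda>p. p $ i / p $ 1) has_derivative (\<lambda>w. (w $ i * p $ 1 - p $ i * w $ 1) / (p $ 1)\<^sup>2)) (at p)" for i
    using has_derivative_divide'[OF has_derivative_component has_derivative_component assms, of i]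
    by (simp add: power2_eq_square)
  from this[of 2] this[of 3] show ?thesis
    by (subst has_derivative_componentwise_within) (auto simp: Basis_complex_def Klein_def)
qed

text \<open>The first term is the rotation with angular speed \<open>ubar u\<close>; the second is the part that has to be
  shown to vanish at the circle.\<close>

lemma Klein_push_V_gr:
  assumes u: "smooth_H2 u" and \<eta>: "\<eta> \<in> ball 0 1"
  shows "Klein_push (V_gr u) \<eta> = \<i> * \<eta> * of_real (ubar u \<eta>)
    + \<i> * of_real (1 - (cmod \<eta>)\<^sup>2) * klein_grad (u \<circ> hparam) (klein_coords \<eta>)"
proof -
  define q where "q = klein_coords \<eta>"
  let ?f = "u \<circ> hparam"
  have K: "\<eta> = Klein (hparam q)" using Klein_klein_coords[OF \<eta>] by (simp add: q_def)
  have ne: "hparam q $ 1 \<noteq> 0" by simp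
  have der: "frechet_derivative Klein (at (hparam q)) w = Complex ((w $ 2 * height q - q $ 1 * w $ 1) / hsq q)
    ((w $ 3 * height q - q $ 2 * w $ 1) / hsq q)" for w
    using fun_cong[OF frechet_derivative_at[OF Klein_has_derivative[OF ne]], of w, symmetric]
    by (simp add: less_imp_le)
  have push: "Klein_push (V_gr u) \<eta> = frechet_derivative Klein (at (hparam q)) (V_gr u (hparam q))"
    using \<eta> by (simp add: Klein_push_def inv_into_Klein q_def Let_def)
  have hh: "height q * a * height q = hsq q * a" "a / height q * (b / height q) = a * b / hsq q" for a b
    by (simp_all add: less_imp_le mult.commute mult.left_commute)
  have w: "V_gr u (hparam q) = vector [q $ 2 * partial_d 1 ?f q - q $ 1 * partial_d 2 ?f q,
      - (height q * partial_d 2 ?f q), height q * partial_d 1 ?f q]"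
    unfolding V_gr_hparam[OF u] by (simp add: dparam_eq vec_eq_iff forall_3 field_simps)
  have "Klein_push (V_gr u) \<eta> = Complex
     ((- (hsq q * partial_d 2 ?f q) - q $ 1 * (q $ 2 * partial_d 1 ?f q - q $ 1 * partial_d 2 ?f q)) / hsq q)
     ((hsq q * partial_d 1 ?f q - q $ 2 * (q $ 2 * partial_d 1 ?f q - q $ 1 * partial_d 2 ?f q)) / hsq q)"
    unfolding push der w by (simp add: hh)
  also have "\<dots> = \<i> * Klein (hparam q) * of_real (u (hparam q) / height q) + \<i> * of_real (1 / hsq q) * klein_grad ?f q"
    by (simp add: complex_eq_iff Klein_hparam hh(2) field_simps) (simp add: hsq_def algebra_simps power2_eq_square)
  finally show ?thesis
    by (simp add: K ubar_Klein cmod_Klein_hparam klein_coords_Klein)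
qed

section \<open>The Hessian and the operator dbar\<close>

text \<open>The complex structure in the chart, multiplied by the height. Without the square root, identities between
  such operators are polynomial.\<close>

definition scaled_rot :: "real^2 \<Rightarrow> real^2 \<Rightarrow> real^2" where
  "scaled_rot q \<xi> = vector [q $ 1 * q $ 2 * \<xi> $ 1 - (1 + q $ 1 * q $ 1) * \<xi> $ 2,
     (1 + q $ 2 * q $ 2) * \<xi> $ 1 - q $ 1 * q $ 2 * \<xi> $ 2]"

definition rot :: "real^2 \<Rightarrow> real^2 \<Rightarrow> real^2" where
  "rot q \<xi> = (1 / height q) *\<^sub>R scaled_rot q \<xi>"

text \<open>Moves a height from the numerator to the denominator, where it can be cancelled: square roots then occur
  only as a common denominator.\<close>

lemma height_eq_divide: "height q * x = hsq q * x / height q"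
proof -
  have "height q * x = (height q * height q) * x / height q" by (simp del: real_sqrt_mult_self)
  then show ?thesis by (simp add: less_imp_le)
qed

lemma dparam_linear: "dparam q (\<xi> + \<eta>) = dparam q \<xi> + dparam q \<eta>" "dparam q (c *\<^sub>R \<xi>) = c *\<^sub>R dparam q \<xi>"
  by (simp_all add: dparam_eq vec_eq_iff forall_3 add_divide_distrib[symmetric] algebra_simps)

lemma JJ_dparam: "JJ (hparam q) (dparam q \<xi>) = dparam q (rot q \<xi>)"
proof -
  let ?s = "q $ 1 * \<xi> $ 1 + q $ 2 * \<xi> $ 2"
  have "JJ (hparam q) (dparam q \<xi>) = vector [(q $ 2 * \<xi> $ 1 - q $ 1 * \<xi> $ 2),
      (q $ 2 * ?s - hsq q * \<xi> $ 2) / height q, (hsq q * \<xi> $ 1 - q $ 1 * ?s) / height q]"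
    by (simp add: JJ_def mcross_eq dparam_eq vec_eq_iff forall_3 height_eq_divide diff_divide_distrib)
  also have "\<dots> = dparam q (rot q \<xi>)"
  proof -
    have "q $ 1 * scaled_rot q \<xi> $ 1 + q $ 2 * scaled_rot q \<xi> $ 2 = hsq q * (q $ 2 * \<xi> $ 1 - q $ 1 * \<xi> $ 2)"
      by (simp add: scaled_rot_def hsq_def power2_eq_square algebra_simps)
    then have "q $ 2 * \<xi> $ 1 - q $ 1 * \<xi> $ 2
        = (q $ 1 * scaled_rot q \<xi> $ 1 + q $ 2 * scaled_rot q \<xi> $ 2) / (height q * height q)"
      by (simp add: less_imp_le)
    moreover have "q $ 2 * ?s - hsq q * \<xi> $ 2 = scaled_rot q \<xi> $ 1" "hsq q * \<xi> $ 1 - q $ 1 * ?s = scaled_rot q \<xi> $ 2"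
      by (simp_all add: scaled_rot_def hsq_def power2_eq_square algebra_simps)
    ultimately show ?thesis
      by (simp add: rot_def dparam_linear) (simp add: dparam_eq vec_eq_iff forall_3)
  qed
  finally show ?thesis .
qed

lemma scaled_rot_linear: "scaled_rot q (\<xi> + \<eta>) = scaled_rot q \<xi> + scaled_rot q \<eta>" "scaled_rot q (c *\<^sub>R \<xi>) = c *\<^sub>R scaled_rot q \<xi>"
  by (simp_all add: scaled_rot_def vec_eq_iff forall_2 algebra_simps)

lemma rot_linear: "rot q (\<xi> + \<eta>) = rot q \<xi> + rot q \<eta>" "rot q (c *\<^sub>R \<xi>) = c *\<^sub>R rot q \<xi>"
  by (simp_all add: rot_def scaled_rot_linear algebra_simps)

lemma rot_minus: "rot q (- \<xi>) = - rot q \<xi>"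
  using rot_linear(2)[of q "-1" \<xi>] by simp

lemma scale_height_twice: "(1 / height q) *\<^sub>R (1 / height q) *\<^sub>R x = (1 / hsq q) *\<^sub>R (x :: real^2)"
  by (simp add: less_imp_le)

lemma rot_rot: "rot q (rot q \<xi>) = - \<xi>"
proof -
  have "scaled_rot q (scaled_rot q \<xi>) = hsq q *\<^sub>R (- \<xi>)"
    by (simp add: scaled_rot_def vec_eq_iff forall_2 hsq_def algebra_simps power2_eq_square)
  then show ?thesis
    unfolding rot_def scaled_rot_linear scale_height_twice by simp
qed

lemma mink_rot: "mink (dparam q (rot q \<xi>)) (dparam q (rot q \<xi>)) = mink (dparam q \<xi>) (dparam q \<xi>)"
proof -
  have scale: "mink (c *\<^sub>R x) (c *\<^sub>R x) = c\<^sup>2 * mink x x" for c x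
    by (simp add: mink_def algebra_simps power2_eq_square)
  have mult: "mink (dparam q \<xi>) (dparam q \<xi>) =
      (hsq q * (\<xi> $ 1 * \<xi> $ 1 + \<xi> $ 2 * \<xi> $ 2) - (q $ 1 * \<xi> $ 1 + q $ 2 * \<xi> $ 2) * (q $ 1 * \<xi> $ 1 + q $ 2 * \<xi> $ 2)) / hsq q" for \<xi>
    by (simp add: mink_dparam diff_divide_distrib)
  let ?r = "scaled_rot q \<xi>"
  have "hsq q * (?r $ 1 * ?r $ 1 + ?r $ 2 * ?r $ 2) - (q $ 1 * ?r $ 1 + q $ 2 * ?r $ 2) * (q $ 1 * ?r $ 1 + q $ 2 * ?r $ 2)
    = hsq q * (hsq q * (\<xi> $ 1 * \<xi> $ 1 + \<xi> $ 2 * \<xi> $ 2) - (q $ 1 * \<xi> $ 1 + q $ 2 * \<xi> $ 2) * (q $ 1 * \<xi> $ 1 + q $ 2 * \<xi> $ 2))"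
    by (simp add: scaled_rot_def hsq_def algebra_simps power2_eq_square)
  then show ?thesis
    unfolding rot_def dparam_linear scale mult by (simp add: power_divide less_imp_le)
qed

text \<open>The operator \<open>B = Hess u - u g\<close> on tangent vectors: since \<open>Hess u = \<partial>\<partial>f + g (q \<cdot> \<partial>f)\<close> as a bilinear form,
  raising an index adds \<open>q \<cdot> \<partial>f\<close> times the identity to the operator obtained from the second
  derivatives, and \<open>- u g\<close> subtracts \<open>f q\<close> times the identity.\<close>

definition hess_op :: "(real^2 \<Rightarrow> real) \<Rightarrow> real^2 \<Rightarrow> real^2 \<Rightarrow> real^2" where
  "hess_op f q \<xi> = (\<chi> k. (\<Sum>j\<in>UNIV. (of_bool (k = j) + q $ k * q $ j) * (\<Sum>i\<in>UNIV. \<xi> $ i * partial_d i (partial_d j f) q))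
     + (q $ 1 * partial_d 1 f q + q $ 2 * partial_d 2 f q - f q) * \<xi> $ k)"

lemma klein_grad_has_derivative:
  assumes f: "smooth_fun f"
  shows "(klein_grad f has_derivative (\<lambda>\<xi>. Complex (hess_op f q \<xi> $ 1) (hess_op f q \<xi> $ 2))) (at q)"
proof -
  have d: "f differentiable (at q)" "partial_d i f differentiable (at q)" for i
    using f by (auto intro: smooth_fun_differentiable smooth_fun_partial_d)
  note D = has_derivative_partial_d[OF d(1)] has_derivative_partial_d[OF d(2)]
  have "((\<lambda>q. Re (klein_grad f q)) has_derivative (\<lambda>\<xi>. hess_op f q \<xi> $ 1)) (at q)"
    "((\<lambda>q. Im (klein_grad f q)) has_derivative (\<lambda>\<xi>. hess_op f q \<xi> $ 2)) (at q)"
    unfolding klein_grad_sel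
    by (auto intro!: derivative_eq_intros D has_derivative_component simp: hess_op_def sum_2 algebra_simps)
  then show ?thesis
    by (subst has_derivative_componentwise_within) (auto simp: Basis_complex_def)
qed

lemma hess_op_linear: "hess_op f q (c *\<^sub>R \<xi>) = c *\<^sub>R hess_op f q \<xi>"
  by (simp add: hess_op_def vec_eq_iff sum_2 algebra_simps)

text \<open>Conjugation by the complex structure maps a self-adjoint operator of the plane to its adjugate, up to sign,
  and \<open>B\<close> plus its adjugate is the trace of \<open>B\<close>, which is \<open>massive_laplacian f q\<close>.\<close>

lemma traceless_hess_op:
  assumes f: "smooth_fun f"
  shows "hess_op f q \<xi> + rot q (hess_op f q (rot q \<xi>)) = 2 *\<^sub>R hess_op f q \<xi> - massive_laplacian f q *\<^sub>R \<xi>"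
proof -
  have "scaled_rot q (hess_op f q (scaled_rot q \<xi>)) = hsq q *\<^sub>R (hess_op f q \<xi> - massive_laplacian f q *\<^sub>R \<xi>)"
    using partial_d_commute[OF f, of 2 1 q]
    by (simp add: scaled_rot_def hess_op_def massive_laplacian_def sum_2 vec_eq_iff forall_2 hsq_def algebra_simps power2_eq_square)
  then have "rot q (hess_op f q (rot q \<xi>)) = hess_op f q \<xi> - massive_laplacian f q *\<^sub>R \<xi>"
    unfolding rot_def scaled_rot_linear hess_op_linear scale_height_twice by simp
  then show ?thesis by (simp add: scaleR_2)
qed

text \<open>The complex structure is parallel, so \<open>\<nabla> (J grad u) = J Hess u\<close>, and \<open>Hess u = B + u g\<close>.\<close>

lemma nabla_V_gr:
  assumes u: "smooth_H2 u"
  defines "f \<equiv> u \<circ> hparam"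
  shows "nabla (V_gr u) (hparam q) (dparam q \<xi>) = dparam q (rot q (hess_op f q \<xi> + f q *\<^sub>R \<xi>))"
proof -
  let ?W = "vf_coords (V_gr u)"
  have sm: "smooth_fun f" using u by (simp add: smooth_H2_def f_def)
  have d: "partial_d i f differentiable (at q)" for i
    using sm by (auto intro: smooth_fun_differentiable smooth_fun_partial_d)
  note D = has_derivative_partial_d[OF d]
  let ?s = "q $ 1 * \<xi> $ 1 + q $ 2 * \<xi> $ 2"
  let ?F = "\<lambda>j. \<xi> $ 1 * partial_d 1 (partial_d j f) q + \<xi> $ 2 * partial_d 2 (partial_d j f) q"
  have W: "?W = (\<lambda>q. vector [- (height q * partial_d 2 f q), height q * partial_d 1 f q])"
    using vf_coords_V_gr[OF u] by (simp add: fun_eq_iff f_def)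
  have hf: "((\<lambda>q. height q * partial_d j f q) has_derivative (\<lambda>\<xi>. height q * (\<xi> $ 1 * partial_d 1 (partial_d j f) q + \<xi> $ 2 * partial_d 2 (partial_d j f) q)
      + (q $ 1 * \<xi> $ 1 + q $ 2 * \<xi> $ 2) / height q * partial_d j f q)) (at q)" for j
    by (rule has_derivative_mult[OF has_derivative_height D])
  have "((\<lambda>q. ?W q $ i) has_derivative (\<lambda>\<xi>. vector
       [- (height q * (\<xi> $ 1 * partial_d 1 (partial_d 2 f) q + \<xi> $ 2 * partial_d 2 (partial_d 2 f) q)
      + (q $ 1 * \<xi> $ 1 + q $ 2 * \<xi> $ 2) / height q * partial_d 2 f q),
        height q * (\<xi> $ 1 * partial_d 1 (partial_d 1 f) q + \<xi> $ 2 * partial_d 2 (partial_d 1 f) q)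
      + (q $ 1 * \<xi> $ 1 + q $ 2 * \<xi> $ 2) / height q * partial_d 1 f q] $ i)) (at q)" for i
    using exhaust_2[of i] has_derivative_minus[OF hf[of 2]] hf[of 1] unfolding W by (elim disjE) simp_all
  then have "(?W has_derivative (\<lambda>\<xi>. vector
       [- (height q * (\<xi> $ 1 * partial_d 1 (partial_d 2 f) q + \<xi> $ 2 * partial_d 2 (partial_d 2 f) q)
      + (q $ 1 * \<xi> $ 1 + q $ 2 * \<xi> $ 2) / height q * partial_d 2 f q),
        height q * (\<xi> $ 1 * partial_d 1 (partial_d 1 f) q + \<xi> $ 2 * partial_d 2 (partial_d 1 f) q)
      + (q $ 1 * \<xi> $ 1 + q $ 2 * \<xi> $ 2) / height q * partial_d 1 f q])) (at q)"
    by (subst has_derivative_componentwise_within) (auto simp: Basis_vec_def inner_axis)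
  from fun_cong[OF frechet_derivative_at[OF this], of \<xi>] have der: "frechet_derivative ?W (at q) \<xi> =
      vector [- (height q * ?F 2 + ?s / height q * partial_d 2 f q), height q * ?F 1 + ?s / height q * partial_d 1 f q]"
    by (rule sym)
  let ?m = "hsq q * (\<xi> $ 2 * partial_d 1 f q - \<xi> $ 1 * partial_d 2 f q) - ?s * (q $ 2 * partial_d 1 f q - q $ 1 * partial_d 2 f q)"
  have m: "mink (dparam q \<xi>) (dparam q (?W q)) = ?m / height q"
  proof -
    have "mink (dparam q \<xi>) (dparam q (?W q)) = height q * (\<xi> $ 2 * partial_d 1 f q - \<xi> $ 1 * partial_d 2 f q)
       - height q * (?s * (q $ 2 * partial_d 1 f q - q $ 1 * partial_d 2 f q) / hsq q)"
      unfolding W mink_dparam by (simp add: algebra_simps add_divide_distrib diff_divide_distrib)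
    then show ?thesis
      unfolding height_eq_divide[of _ "_ - _"] height_eq_divide[of _ "_ / _"] by (simp add: diff_divide_distrib)
  qed
  have "frechet_derivative ?W (at q) \<xi> + conn_H2 q \<xi> (?W q) = (1 / height q) *\<^sub>R
     vector [- (hsq q * ?F 2 + ?s * partial_d 2 f q) - ?m * q $ 1, hsq q * ?F 1 + ?s * partial_d 1 f q - ?m * q $ 2]"
    unfolding der conn_H2_eq m
    by (simp add: vec_eq_iff forall_2 height_eq_divide diff_divide_distrib add_divide_distrib)
      (simp add: diff_divide_distrib add_divide_distrib algebra_simps)
  also have "\<dots> = rot q (hess_op f q \<xi> + f q *\<^sub>R \<xi>)"
  proof -
    have "vector [- (hsq q * ?F 2 + ?s * partial_d 2 f q) - ?m * q $ 1, hsq q * ?F 1 + ?s * partial_d 1 f q - ?m * q $ 2]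
      = scaled_rot q (hess_op f q \<xi> + f q *\<^sub>R \<xi>)"
      by (simp add: scaled_rot_def hess_op_def sum_2 vec_eq_iff forall_2 hsq_def algebra_simps power2_eq_square)
    then show ?thesis by (simp add: rot_def)
  qed
  finally show ?thesis
    by (simp add: nabla_def hchart_hparam hchart_dparam)
qed

lemma dbar_V_gr:
  assumes u: "smooth_H2 u"
  defines "f \<equiv> u \<circ> hparam"
  shows "JJ (hparam q) (dbar (V_gr u) (hparam q) (dparam q \<xi>))
    = dparam q ((massive_laplacian f q / 2) *\<^sub>R \<xi> - hess_op f q \<xi>)"
proof -
  let ?B = "hess_op f q"
  have sm: "smooth_fun f" using u by (simp add: smooth_H2_def f_def)
  have "dbar (V_gr u) (hparam q) (dparam q \<xi>) =
     dparam q ((1/2) *\<^sub>R (rot q (?B \<xi> + f q *\<^sub>R \<xi>) + rot q (rot q (?B (rot q \<xi>) + f q *\<^sub>R rot q \<xi>))))"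
    unfolding dbar_def JJ_dparam nabla_V_gr[OF u] f_def[symmetric] by (simp add: dparam_linear)
  also have "(1/2) *\<^sub>R (rot q (?B \<xi> + f q *\<^sub>R \<xi>) + rot q (rot q (?B (rot q \<xi>) + f q *\<^sub>R rot q \<xi>)))
     = (1/2) *\<^sub>R (rot q (?B \<xi> + rot q (?B (rot q \<xi>))))"
    unfolding rot_linear by (simp add: rot_rot rot_minus)
  also have "\<dots> = rot q (?B \<xi> - (massive_laplacian f q / 2) *\<^sub>R \<xi>)"
    unfolding traceless_hess_op[OF sm] rot_linear(2)[symmetric] by (simp add: algebra_simps)
  finally show ?thesis
    unfolding JJ_dparam by (simp add: JJ_dparam rot_rot)
qed

text \<open>The smaller eigenvalue of the metric in the chart is \<open>1 / x\<^sub>0\<^sup>2\<close>, by the Cauchy-Schwarz inequality.\<close>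

lemma norm_le_gnorm: "norm \<xi> \<le> height q * gnorm (dparam q \<xi>)"
proof -
  have "(q $ 1 * \<xi> $ 1 + q $ 2 * \<xi> $ 2)\<^sup>2 \<le> (hsq q - 1) * (norm \<xi>)\<^sup>2"
  proof -
    have "(hsq q - 1) * (norm \<xi>)\<^sup>2 - (q $ 1 * \<xi> $ 1 + q $ 2 * \<xi> $ 2)\<^sup>2 = (q $ 1 * \<xi> $ 2 - q $ 2 * \<xi> $ 1)\<^sup>2"
      unfolding power2_norm_eq_inner by (simp add: inner_vec_def sum_2 hsq_def power2_eq_square algebra_simps)
    then show ?thesis by (metis diff_ge_0_iff_ge zero_le_power2)
  qed
  then have "(norm \<xi>)\<^sup>2 \<le> hsq q * mink (dparam q \<xi>) (dparam q \<xi>)"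
  proof -
    have "hsq q * mink (dparam q \<xi>) (dparam q \<xi>) = hsq q * (norm \<xi>)\<^sup>2 - (q $ 1 * \<xi> $ 1 + q $ 2 * \<xi> $ 2)\<^sup>2"
      unfolding power2_norm_eq_inner mink_dparam
      by (simp add: inner_vec_def sum_2 right_diff_distrib[of "hsq q"] power2_eq_square)
    with \<open>_ \<le> _\<close> show ?thesis by (simp add: left_diff_distrib)
  qed
  then have "sqrt ((norm \<xi>)\<^sup>2) \<le> sqrt (hsq q * mink (dparam q \<xi>) (dparam q \<xi>))"
    by (rule real_sqrt_le_mono)
  then show ?thesis by (simp add: gnorm_def real_sqrt_mult)
qed

lemma dbar_norm_bound:
  assumes "dbar_norm V < \<infinity>"
  obtains M where "M \<ge> 0" "\<And>p v. p \<in> H2 \<Longrightarrow> v \<in> tangent_H2 p \<Longrightarrow> gnorm v \<le> 1 \<Longrightarrow> gnorm (dbar V p v) \<le> M"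
proof (rule that[of "enn2real (dbar_norm V)"])
  fix p v assume p: "p \<in> H2" and v: "v \<in> tangent_H2 p" "gnorm v \<le> 1"
  have "ennreal (gnorm (dbar V p v)) \<le> opnorm_H2 p (dbar V p)"
    unfolding opnorm_H2_def by (rule SUP_upper) (use v in simp)
  also have "\<dots> \<le> dbar_norm V"
    unfolding dbar_norm_def by (rule SUP_upper) (rule p)
  also have "\<dots> = ennreal (enn2real (dbar_norm V))"
    using assms by (simp add: ennreal_enn2real_if)
  finally show "gnorm (dbar V p v) \<le> enn2real (dbar_norm V)"
    by simp
qed simp

text \<open>In direction \<open>q\<close> two factors cancel: a hyperbolic unit vector there is \<open>x\<^sub>0 / \<bar>q\<bar>\<close> times \<open>q\<close>, and the
  comparison of norms in \<open>norm_le_gnorm\<close> loses the same factor \<open>x\<^sub>0\<close>. So the bound has no growth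
  beyond that of \<open>q\<close>.\<close>

lemma hess_op_radial_bound:
  assumes u: "smooth_H2 u" and k: "\<And>q. massive_laplacian (u \<circ> hparam) q = k"
    and fin: "dbar_norm (V_gr u) < \<infinity>"
  obtains M where "M \<ge> 0" "\<And>q. norm (hess_op (u \<circ> hparam) q q) \<le> M * norm q"
proof -
  let ?f = "u \<circ> hparam"
  obtain M where M: "M \<ge> 0" "\<And>p v. p \<in> H2 \<Longrightarrow> v \<in> tangent_H2 p \<Longrightarrow> gnorm v \<le> 1 \<Longrightarrow> gnorm (dbar (V_gr u) p v) \<le> M"
    using dbar_norm_bound[OF fin] by blast
  have "norm (hess_op ?f q q) \<le> (M + \<bar>k\<bar> / 2) * norm q" for q
  proof (cases "q = 0")
    case True
    then show ?thesis using hess_op_linear[of ?f q 0 q] by simp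
  next
    case False
    \<comment> \<open>The factor that makes \<open>c q\<close> a hyperbolic unit vector.\<close>
    define c where "c = height q / norm q"
    have c: "c > 0" using False by (simp add: c_def)
    have nq: "q $ 1 * q $ 1 + q $ 2 * q $ 2 = (norm q)\<^sup>2"
      by (simp add: power2_norm_eq_inner inner_vec_def sum_2)
    have hn: "hsq q = 1 + (norm q)\<^sup>2" unfolding nq[symmetric] by (simp add: hsq_def power2_eq_square)
    have "mink (dparam q (c *\<^sub>R q)) (dparam q (c *\<^sub>R q)) = c\<^sup>2 * ((q $ 1 * q $ 1 + q $ 2 * q $ 2) - (q $ 1 * q $ 1 + q $ 2 * q $ 2)\<^sup>2 / hsq q)"
      by (simp add: mink_dparam algebra_simps power2_eq_square)
    also have "\<dots> = 1"
    proof -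
      have cancel: "(1 + n) / n * (n - n\<^sup>2 / (1 + n)) = 1" if "n > 0" for n :: real
        using that add_pos_pos[of n "n * n"] by (simp add: field_simps power2_eq_square)
      have "c\<^sup>2 = (1 + (norm q)\<^sup>2) / (norm q)\<^sup>2"
        by (simp add: c_def power_divide less_imp_le hn)
      then show ?thesis unfolding nq hn using cancel[of "(norm q)\<^sup>2"] False by simp
    qed
    finally have g1: "gnorm (dparam q (c *\<^sub>R q)) = 1" by (simp add: gnorm_def)
    let ?\<xi> = "(k / 2) *\<^sub>R (c *\<^sub>R q) - hess_op ?f q (c *\<^sub>R q)"
    have "norm ?\<xi> \<le> height q * gnorm (dparam q ?\<xi>)" by (rule norm_le_gnorm)
    also have "gnorm (dparam q ?\<xi>) = gnorm (dbar (V_gr u) (hparam q) (dparam q (c *\<^sub>R q)))"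
    proof -
      let ?w = "dbar (V_gr u) (hparam q) (dparam q (c *\<^sub>R q))"
      obtain \<zeta> where "?w = dparam q \<zeta>"
        unfolding dbar_def nabla_V_gr[OF u] JJ_dparam dparam_linear[symmetric] by blast
      then have "gnorm (JJ (hparam q) ?w) = gnorm ?w"
        by (simp add: JJ_dparam gnorm_def mink_rot)
      then show ?thesis unfolding dbar_V_gr[OF u] k .
    qed
    also have "height q * \<dots> \<le> height q * M"
      using M(2)[OF hparam_in_H2 dparam_in_tangent_H2, of q "c *\<^sub>R q"] g1 by (intro mult_left_mono) (simp_all add: less_imp_le)
    also have "?\<xi> = c *\<^sub>R ((k / 2) *\<^sub>R q - hess_op ?f q q)"
      unfolding hess_op_linear by (simp add: algebra_simps)
    finally have "c * norm ((k / 2) *\<^sub>R q - hess_op ?f q q) \<le> height q * M" using c by simp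
    then have "norm ((k / 2) *\<^sub>R q - hess_op ?f q q) \<le> M * norm q"
      using False by (simp add: c_def field_simps)
    then have "norm (hess_op ?f q q) \<le> norm ((k / 2) *\<^sub>R q) + M * norm q"
      using norm_triangle_ineq4[of "(k / 2) *\<^sub>R q" "(k / 2) *\<^sub>R q - hess_op ?f q q"] by simp
    then show ?thesis by (simp add: algebra_simps)
  qed
  with M(1) show ?thesis by (intro that[of "M + \<bar>k\<bar> / 2"]) auto
qed

section \<open>Continuous extension to the circle\<close>

text \<open>Along the ray \<open>t q\<close> the derivative of \<open>klein_grad f\<close> is the value of \<open>B\<close> on a radial vector.\<close>

lemma klein_grad_growth:
  assumes f: "smooth_fun f" and M: "\<And>q. norm (hess_op f q q) \<le> M * norm q"
  shows "cmod (klein_grad f q) \<le> cmod (klein_grad f 0) + M * norm q"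
proof -
  let ?C = "\<lambda>v :: real^2. Complex (v $ 1) (v $ 2)"
  have cmod_eq: "cmod (?C v) = norm v" for v
    by (simp add: norm_vec_def L2_set_def sum_2 cmod_def)
  have line: "((\<lambda>t. t *\<^sub>R q) has_derivative (\<lambda>s. s *\<^sub>R q)) (at t)" for t
    by (auto intro!: derivative_eq_intros)
  have der: "((\<lambda>t. klein_grad f (t *\<^sub>R q)) has_derivative (\<lambda>s. ?C (hess_op f (t *\<^sub>R q) (s *\<^sub>R q)))) (at t)" for t
    by (rule has_derivative_compose[OF line klein_grad_has_derivative[OF f]])
  have "\<exists>t\<in>{0<..<1}. norm (klein_grad f (1 *\<^sub>R q) - klein_grad f (0 *\<^sub>R q)) \<le> norm (?C (hess_op f (t *\<^sub>R q) ((1 - 0) *\<^sub>R q)))"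
    by (rule mvt_general[OF zero_less_one _ der])
      (rule has_derivative_continuous_on[OF has_derivative_at_withinI[OF der]])
  then obtain t where t: "0 < t" "cmod (klein_grad f q - klein_grad f 0) \<le> norm (hess_op f (t *\<^sub>R q) q)"
    unfolding cmod_eq by auto
  have "t * norm (hess_op f (t *\<^sub>R q) q) = norm (hess_op f (t *\<^sub>R q) (t *\<^sub>R q))"
    using t(1) by (simp add: hess_op_linear)
  also have "\<dots> \<le> t * (M * norm q)" using M[of "t *\<^sub>R q"] t(1) by (simp add: mult.left_commute)
  finally have "norm (hess_op f (t *\<^sub>R q) q) \<le> M * norm q" using t(1) by simp
  then show ?thesis using t(2) norm_triangle_sub[of "klein_grad f q" "klein_grad f 0"] by linarith
qed

lemma norm_klein_coords:
  assumes "\<eta> \<in> ball 0 1"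
  shows "norm (klein_coords \<eta>) = cmod \<eta> / sqrt (1 - (cmod \<eta>)\<^sup>2)"
proof -
  define d where "d = 1 - (cmod \<eta>)\<^sup>2"
  have d: "d > 0" using ball_pos[OF assms] by (simp add: d_def)
  have "(norm (klein_coords \<eta>))\<^sup>2 = (klein_coords \<eta> $ 1)\<^sup>2 + (klein_coords \<eta> $ 2)\<^sup>2"
    by (simp add: norm_vec_def L2_set_def sum_2)
  also have "\<dots> = ((Re \<eta>)\<^sup>2 + (Im \<eta>)\<^sup>2) / d"
    using d by (simp add: d_def[symmetric] power_divide add_divide_distrib)
  finally have "(norm (klein_coords \<eta>))\<^sup>2 = (cmod \<eta>)\<^sup>2 / (1 - (cmod \<eta>)\<^sup>2)"
    unfolding d_def cmod_power2[of \<eta>, symmetric] .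
  then have "sqrt ((norm (klein_coords \<eta>))\<^sup>2) = sqrt ((cmod \<eta>)\<^sup>2 / (1 - (cmod \<eta>)\<^sup>2))" by simp
  then show ?thesis by (simp add: real_sqrt_divide)
qed

text \<open>An antiderivative of \<open>C + M t / sqrt (1 - t\<^sup>2)\<close>, the bound for the radial derivative of \<open>ubar u\<close>. What matters
  is that it is finite and continuous at \<open>t = 1\<close>.\<close>

definition radial_bound :: "real \<Rightarrow> real \<Rightarrow> real \<Rightarrow> real" where
  "radial_bound C M t = C * t - M * sqrt (1 - t\<^sup>2)"

lemma radial_bound_deriv:
  assumes "0 \<le> t" "t < 1"
  shows "(radial_bound C M has_real_derivative C + M * t / sqrt (1 - t\<^sup>2)) (at t)"
proof -
  have "1 - t\<^sup>2 > 0" using assms by (simp add: abs_square_less_1)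
  then show ?thesis
    unfolding radial_bound_def[abs_def]
    by (auto intro!: derivative_eq_intros simp: field_simps)
qed

text \<open>The point \<open>t \<eta>\<close> has distance at most \<open>t\<close> from the centre, whatever \<open>\<eta>\<close> in the closed disk is, so the radial
  derivative of \<open>ubar u\<close> is bounded by that of \<open>radial_bound C M\<close> uniformly in \<open>\<eta>\<close>.\<close>

lemma ubar_radial_le:
  assumes u: "smooth_H2 u" and C: "C \<ge> 0" and M: "M \<ge> 0"
    and growth: "\<And>q. cmod (klein_grad (u \<circ> hparam) q) \<le> C + M * norm q"
    and \<eta>: "\<eta> \<in> cball 0 1" and s: "0 \<le> s" "s \<le> s'" "s' < 1"
  shows "\<bar>ubar u (s' *\<^sub>R \<eta>) - ubar u (s *\<^sub>R \<eta>)\<bar> \<le> radial_bound C M s' - radial_bound C M s"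
proof -
  let ?G = "\<lambda>t. klein_grad (u \<circ> hparam) (klein_coords (t *\<^sub>R \<eta>)) \<bullet> \<eta>"
  have ball: "t *\<^sub>R \<eta> \<in> ball 0 1" if "0 \<le> t" "t < 1" for t
    using that \<eta> mult_right_le_one_le[of t "cmod \<eta>"] by (simp)
  have der: "((\<lambda>t. ubar u (t *\<^sub>R \<eta>)) has_real_derivative ?G t) (at t)" if "0 \<le> t" "t < 1" for t
  proof -
    have "((\<lambda>t. t *\<^sub>R \<eta>) has_derivative (\<lambda>s. s *\<^sub>R \<eta>)) (at t)" by (auto intro!: derivative_eq_intros)
    from has_derivative_compose[OF this ubar_has_derivative[OF u ball[OF that]]]
    show ?thesis unfolding has_field_derivative_def
      by (rule has_derivative_eq_rhs) (simp add: fun_eq_iff mult.commute)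
  qed
  have bound: "\<bar>?G t\<bar> \<le> C + M * t / sqrt (1 - t\<^sup>2)" if t: "0 \<le> t" "t < 1" for t
  proof -
    have r: "cmod \<eta> \<le> 1" using \<eta> by simp
    have tr: "t * cmod \<eta> \<le> t" using t r by (simp add: mult_right_le_one_le)
    have t1: "1 - t\<^sup>2 > 0" using t by (simp add: abs_square_less_1)
    have "(t * cmod \<eta>)\<^sup>2 \<le> t\<^sup>2" using tr t by (intro power_mono) auto
    then have root: "sqrt (1 - t\<^sup>2) \<le> sqrt (1 - (t * cmod \<eta>)\<^sup>2)" by simp
    have "norm (klein_coords (t *\<^sub>R \<eta>)) = t * cmod \<eta> / sqrt (1 - (t * cmod \<eta>)\<^sup>2)"
      using norm_klein_coords[OF ball[OF t]] t(1) by simp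
    also have "\<dots> \<le> t / sqrt (1 - t\<^sup>2)"
      using tr t t1 root by (intro frac_le) auto
    finally have n: "norm (klein_coords (t *\<^sub>R \<eta>)) \<le> t / sqrt (1 - t\<^sup>2)" .
    have "\<bar>?G t\<bar> \<le> cmod (klein_grad (u \<circ> hparam) (klein_coords (t *\<^sub>R \<eta>))) * cmod \<eta>"
      by (rule Cauchy_Schwarz_ineq2)
    also have "\<dots> \<le> cmod (klein_grad (u \<circ> hparam) (klein_coords (t *\<^sub>R \<eta>)))"
      using r by (simp add: mult_right_le_one_le)
    also have "\<dots> \<le> C + M * norm (klein_coords (t *\<^sub>R \<eta>))" by (rule growth)
    also have "\<dots> \<le> C + M * (t / sqrt (1 - t\<^sup>2))" using mult_left_mono[OF n M] by simp
    finally show ?thesis by simp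
  qed
  have "radial_bound C M s - ubar u (s *\<^sub>R \<eta>) \<le> radial_bound C M s' - ubar u (s' *\<^sub>R \<eta>)"
  proof (rule DERIV_nonneg_imp_nondecreasing[OF s(2)])
    fix t assume "s \<le> t" "t \<le> s'"
    then have t: "0 \<le> t" "t < 1" using s by auto
    have "((\<lambda>t. radial_bound C M t - ubar u (t *\<^sub>R \<eta>)) has_real_derivative (C + M * t / sqrt (1 - t\<^sup>2)) - ?G t) (at t)"
      by (intro DERIV_diff radial_bound_deriv der t)
    moreover have "(C + M * t / sqrt (1 - t\<^sup>2)) - ?G t \<ge> 0" using bound[OF t] by linarith
    ultimately show "\<exists>y. ((\<lambda>t. radial_bound C M t - ubar u (t *\<^sub>R \<eta>)) has_real_derivative y) (at t) \<and> y \<ge> 0" by blast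
  qed
  moreover have "radial_bound C M s + ubar u (s *\<^sub>R \<eta>) \<le> radial_bound C M s' + ubar u (s' *\<^sub>R \<eta>)"
  proof (rule DERIV_nonneg_imp_nondecreasing[OF s(2)])
    fix t assume "s \<le> t" "t \<le> s'"
    then have t: "0 \<le> t" "t < 1" using s by auto
    have "((\<lambda>t. radial_bound C M t + ubar u (t *\<^sub>R \<eta>)) has_real_derivative (C + M * t / sqrt (1 - t\<^sup>2)) + ?G t) (at t)"
      by (intro DERIV_add radial_bound_deriv der t)
    moreover have "(C + M * t / sqrt (1 - t\<^sup>2)) + ?G t \<ge> 0" using bound[OF t] by linarith
    ultimately show "\<exists>y. ((\<lambda>t. radial_bound C M t + ubar u (t *\<^sub>R \<eta>)) has_real_derivative y) (at t) \<and> y \<ge> 0" by blast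
  qed
  ultimately show ?thesis by linarith
qed

lemma continuous_on_ubar: "smooth_H2 u \<Longrightarrow> continuous_on (ball 0 1) (ubar u)"
  by (rule has_derivative_continuous_on[OF has_derivative_at_withinI[OF ubar_has_derivative]])

text \<open>By \<open>ubar_radial_le\<close> the functions \<open>\<eta> \<mapsto> ubar u (s \<eta>)\<close> on the closed disk are uniformly Cauchy as \<open>s\<close>
  tends to 1, and they are continuous; the extension is their limit.\<close>

lemma ubar_extends:
  assumes u: "smooth_H2 u" and C: "C \<ge> 0" and M: "M \<ge> 0"
    and growth: "\<And>q. cmod (klein_grad (u \<circ> hparam) q) \<le> C + M * norm q"
  obtains g where "continuous_on (cball 0 1) g" "\<And>\<eta>. \<eta> \<in> ball 0 1 \<Longrightarrow> g \<eta> = ubar u \<eta>"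
proof -
  define s where "s n = 1 - inverse (real (Suc n))" for n
  have s01: "0 \<le> s n" "s n < 1" for n by (simp_all add: s_def field_simps)
  have mono: "s m \<le> s n" if "m \<le> n" for m n using that by (simp add: s_def field_simps)
  have s_lim: "s \<longlonglongrightarrow> 1"
    using tendsto_diff[OF tendsto_const LIMSEQ_inverse_real_of_nat, of 1] by (simp add: s_def[abs_def])
  define F where "F n \<eta> = ubar u (s n *\<^sub>R \<eta>)" for n and \<eta> :: complex
  have in_ball: "s n *\<^sub>R \<eta> \<in> ball 0 1" if "\<eta> \<in> cball 0 1" for n and \<eta> :: complex
    using that s01[of n] mult_right_le_one_le[of "s n" "cmod \<eta>"] by simp
  have contF: "continuous_on (cball 0 1) (F n)" for n
    unfolding F_def
    by (rule continuous_on_compose2[OF continuous_on_ubar[OF u]]) (use in_ball in \<open>auto intro!: continuous_intros\<close>)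
  have "(\<lambda>n. radial_bound C M (s n)) \<longlonglongrightarrow> radial_bound C M 1"
    unfolding radial_bound_def by (intro tendsto_intros s_lim)
  then have cau: "Cauchy (\<lambda>n. radial_bound C M (s n))" by (rule LIMSEQ_imp_Cauchy)
  have "uniformly_Cauchy_on (cball 0 1) F"
    unfolding uniformly_Cauchy_on_def
  proof (intro allI impI)
    fix e :: real assume "e > 0"
    then obtain N where N: "\<And>m n. m \<ge> N \<Longrightarrow> n \<ge> N \<Longrightarrow> dist (radial_bound C M (s m)) (radial_bound C M (s n)) < e"
      using cau unfolding Cauchy_def by blast
    have le: "dist (F m \<eta>) (F n \<eta>) < e" if "\<eta> \<in> cball 0 1" "m \<ge> N" "n \<ge> N" "m \<le> n" for \<eta> m n
    proof -
      have "\<bar>F n \<eta> - F m \<eta>\<bar> \<le> radial_bound C M (s n) - radial_bound C M (s m)"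
        unfolding F_def by (rule ubar_radial_le[OF u C M growth that(1) s01(1) mono[OF that(4)] s01(2)])
      also have "\<dots> < e" using N[OF that(2,3)] by (simp add: dist_real_def)
      finally show ?thesis by (simp add: dist_real_def abs_minus_commute)
    qed
    show "\<exists>N. \<forall>\<eta>\<in>cball 0 1. \<forall>m\<ge>N. \<forall>n\<ge>N. dist (F m \<eta>) (F n \<eta>) < e"
    proof (intro exI ballI allI impI)
      fix \<eta> :: complex and m n assume "\<eta> \<in> cball 0 1" "N \<le> m" "N \<le> n"
      then show "dist (F m \<eta>) (F n \<eta>) < e"
        using le[of \<eta> m n] le[of \<eta> n m] by (cases "m \<le> n") (auto simp: dist_commute)
    qed
  qed
  then obtain g where g: "uniform_limit (cball 0 1) F g sequentially"
    using Cauchy_uniformly_convergent unfolding uniformly_convergent_on_def by blast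
  have "continuous_on (cball 0 1) g"
    by (rule uniform_limit_theorem[OF _ g]) (simp_all add: contF)
  moreover have "g \<eta> = ubar u \<eta>" if \<eta>: "\<eta> \<in> ball 0 1" for \<eta>
  proof (rule LIMSEQ_unique)
    show "(\<lambda>n. F n \<eta>) \<longlonglongrightarrow> g \<eta>" using tendsto_uniform_limitI[OF g] \<eta> by simp
    have "isCont (ubar u) \<eta>"
      using continuous_on_ubar[OF u] \<eta> by (simp add: continuous_on_eq_continuous_at)
    moreover have "(\<lambda>n. s n *\<^sub>R \<eta>) \<longlonglongrightarrow> 1 *\<^sub>R \<eta>" by (intro tendsto_intros s_lim)
    ultimately show "(\<lambda>n. F n \<eta>) \<longlonglongrightarrow> ubar u \<eta>"
      unfolding F_def scaleR_one by (rule isCont_tendsto_compose)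
  qed
  ultimately show ?thesis using that by blast
qed

lemma V_gr_extends_continuously:
  assumes u: "smooth_H2 u" and M: "M \<ge> 0"
    and growth: "\<And>q. cmod (klein_grad (u \<circ> hparam) q) \<le> C + M * norm q"
    and g: "continuous_on (cball 0 1) g" "\<And>\<eta>. \<eta> \<in> ball 0 1 \<Longrightarrow> g \<eta> = ubar u \<eta>"
  shows "extends_continuously_to (V_gr u) (\<lambda>z. \<i> * z * of_real (g z))"
  unfolding extends_continuously_to_def
proof (intro allI impI, elim conjE)
  fix \<eta> :: "nat \<Rightarrow> complex" and z
  assume \<eta>: "\<forall>n. \<eta> n \<in> ball 0 1" and z: "z \<in> sphere 0 1" and lim: "\<eta> \<longlonglongrightarrow> z"
  let ?R = "\<lambda>n. of_real (1 - (cmod (\<eta> n))\<^sup>2) * klein_grad (u \<circ> hparam) (klein_coords (\<eta> n))"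
  have g_lim: "(\<lambda>n. g (\<eta> n)) \<longlonglongrightarrow> g z"
    by (rule continuous_on_tendsto_compose[OF g(1) lim])
      (use \<eta> z in \<open>auto intro!: always_eventually simp: less_imp_le\<close>)
  have n_lim: "(\<lambda>n. cmod (\<eta> n)) \<longlonglongrightarrow> 1"
    using tendsto_norm[OF lim] z by simp
  have "?R \<longlonglongrightarrow> 0"
  proof (rule Lim_null_comparison)
    show "\<forall>\<^sub>F n in sequentially. norm (?R n) \<le> C * (1 - (cmod (\<eta> n))\<^sup>2) + M * (cmod (\<eta> n) * sqrt (1 - (cmod (\<eta> n))\<^sup>2))"
    proof (intro always_eventually allI)
      fix n
      have b: "\<eta> n \<in> ball 0 1" using \<eta> by blast
      let ?d = "1 - (cmod (\<eta> n))\<^sup>2"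
      have d: "?d > 0" using ball_pos[OF b] .
      have "norm (?R n) = ?d * cmod (klein_grad (u \<circ> hparam) (klein_coords (\<eta> n)))"
        using d by (simp add: norm_mult del: of_real_diff)
      also have "\<dots> \<le> ?d * (C + M * (cmod (\<eta> n) / sqrt ?d))"
        using growth[of "klein_coords (\<eta> n)"] d unfolding norm_klein_coords[OF b] by (intro mult_left_mono) auto
      also have "\<dots> = C * ?d + M * (cmod (\<eta> n) * (?d / sqrt ?d))" by (simp add: algebra_simps)
      also have "?d / sqrt ?d = sqrt ?d" using d by (simp add: real_div_sqrt)
      finally show "norm (?R n) \<le> C * ?d + M * (cmod (\<eta> n) * sqrt ?d)" .
    qed
    have "(\<lambda>n. C * (1 - (cmod (\<eta> n))\<^sup>2) + M * (cmod (\<eta> n) * sqrt (1 - (cmod (\<eta> n))\<^sup>2)))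
        \<longlonglongrightarrow> C * (1 - 1\<^sup>2) + M * (1 * sqrt (1 - 1\<^sup>2))"
      by (intro tendsto_intros n_lim)
    then show "(\<lambda>n. C * (1 - (cmod (\<eta> n))\<^sup>2) + M * (cmod (\<eta> n) * sqrt (1 - (cmod (\<eta> n))\<^sup>2))) \<longlonglongrightarrow> 0" by simp
  qed
  then have "(\<lambda>n. \<i> * \<eta> n * of_real (g (\<eta> n)) + \<i> * ?R n) \<longlonglongrightarrow> \<i> * z * of_real (g z) + \<i> * 0"
    by (intro tendsto_intros lim g_lim)
  moreover have "Klein_push (V_gr u) (\<eta> n) = \<i> * \<eta> n * of_real (g (\<eta> n)) + \<i> * ?R n" for n
    using \<eta> Klein_push_V_gr[OF u, of "\<eta> n"] g(2)[of "\<eta> n"] by (simp add: mult.assoc)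
  ultimately show "(\<lambda>n. Klein_push (V_gr u) (\<eta> n)) \<longlonglongrightarrow> \<i> * z * of_real (g z)" by simp
qed

section \<open>Uniqueness for the boundary value problem\<close>

lemma second_derivative_le_0_at_max:
  fixes P :: "real^2 \<Rightarrow> real"
  assumes P: "\<And>x. P differentiable (at x)" and P': "\<And>j x. partial_d j P differentiable (at x)"
    and max: "\<And>y. P y \<le> P q"
  shows "partial_d i P q = 0"
    and "(\<Sum>i\<in>UNIV. \<Sum>j\<in>UNIV. v $ i * v $ j * partial_d i (partial_d j P) q) \<le> 0"
proof -
  have "frechet_derivative P (at q) = (\<lambda>v. 0)"
    using differential_zero_maxmin[of q UNIV P] P[unfolded frechet_derivative_works] max by blast
  then have grad: "partial_d i P q = 0" for i by (simp add: partial_d_def)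
  then show "partial_d i P q = 0" .
  let ?l = "\<lambda>t. q + t *\<^sub>R v"
  have line: "(?l has_derivative (\<lambda>s. s *\<^sub>R v)) (at t)" for t by (auto intro!: derivative_eq_intros)
  have along: "((\<lambda>t. h (?l t)) has_real_derivative (v $ 1 * partial_d 1 h (?l t) + v $ 2 * partial_d 2 h (?l t))) (at t)"
    if "\<And>x. h differentiable (at x)" for h :: "real^2 \<Rightarrow> real" and t
    using has_derivative_compose[OF line has_derivative_partial_d[OF that]] unfolding has_field_derivative_def
    by (rule has_derivative_eq_rhs) (simp add: fun_eq_iff algebra_simps)
  define D where "D t = v $ 1 * partial_d 1 P (?l t) + v $ 2 * partial_d 2 P (?l t)" for t
  let ?S = "\<Sum>i\<in>UNIV. \<Sum>j\<in>UNIV. v $ i * v $ j * partial_d i (partial_d j P) q"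
  have dP: "((\<lambda>t. P (?l t)) has_real_derivative D t) (at t)" for t
    unfolding D_def by (rule along[OF P])
  have dD: "(D has_real_derivative ?S) (at 0)"
  proof -
    have "(D has_real_derivative v $ 1 * (v $ 1 * partial_d 1 (partial_d 1 P) (?l 0) + v $ 2 * partial_d 2 (partial_d 1 P) (?l 0))
       + v $ 2 * (v $ 1 * partial_d 1 (partial_d 2 P) (?l 0) + v $ 2 * partial_d 2 (partial_d 2 P) (?l 0))) (at 0)"
      unfolding D_def[abs_def] by (intro DERIV_add DERIV_cmult along P')
    then show ?thesis by (simp add: sum_2 algebra_simps)
  qed
  show "?S \<le> 0"
  proof (rule ccontr)
    assume "\<not> ?S \<le> 0"
    then have "?S > 0" by simp
    from DERIV_pos_inc_right[OF dD this] obtain d where d: "d > 0" "\<And>h. h > 0 \<Longrightarrow> h < d \<Longrightarrow> D 0 < D (0 + h)" by blast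
    have D0: "D 0 = 0" by (simp add: D_def grad)
    have "P (?l 0) < P (?l (d / 2))"
    proof (rule DERIV_pos_imp_increasing_open[of 0 "d / 2" "\<lambda>t. P (?l t)"])
      show "0 < d / 2" using d(1) by simp
      fix t assume "0 < t" "t < d / 2"
      then show "\<exists>y. ((\<lambda>t. P (?l t)) has_real_derivative y) (at t) \<and> 0 < y"
        using dP d(2)[of t] D0 by auto
    next
      show "continuous_on {0..d/2} (\<lambda>t. P (?l t))"
        using dP by (meson DERIV_continuous_on has_field_derivative_at_within)
    qed
    with max[of "?l (d / 2)"] show False by simp
  qed
qed

lemma massive_laplacian_diff:
  assumes "\<And>x. f differentiable (at x)" "\<And>j x. partial_d j f differentiable (at x)"
    and "\<And>x. g differentiable (at x)" "\<And>j x. partial_d j g differentiable (at x)"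
  shows "massive_laplacian (\<lambda>q. f q - c * g q) q = massive_laplacian f q - c * massive_laplacian g q"
    and "partial_d j (\<lambda>q. f q - c * g q) = (\<lambda>q. partial_d j f q - c * partial_d j g q)"
proof -
  have *: "partial_d j (\<lambda>q. f q - c * g q) = (\<lambda>q. partial_d j f q - c * partial_d j g q)" for j
    by (simp add: fun_eq_iff partial_d_diff partial_d_mult assms)
  then show "partial_d j (\<lambda>q. f q - c * g q) = (\<lambda>q. partial_d j f q - c * partial_d j g q)" .
  show "massive_laplacian (\<lambda>q. f q - c * g q) q = massive_laplacian f q - c * massive_laplacian g q"
    unfolding massive_laplacian_def * by (simp add: partial_d_diff partial_d_mult assms sum_2 algebra_simps)
qed

lemma massive_laplacian_of_const: "massive_laplacian (\<lambda>q. c) q = - 2 * c"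
  by (simp add: massive_laplacian_def partial_d_const_fun)

lemma massive_laplacian_height: "massive_laplacian height q = 0"
  using massive_laplacian_height_mult[OF smooth_fun_const[of 1], of q]
  by (simp add: partial_d_const_fun)

text \<open>The height \<open>x\<^sub>0\<close> is a positive solution, so if \<open>w / x\<^sub>0\<close> has a positive maximum \<open>m\<close>, then \<open>w - m x\<^sub>0\<close> is a
  solution with maximum value \<open>0\<close>. At the maximum the second-order part of the equation is at most
  \<open>0\<close> and the rest vanishes, which is a contradiction once the equation is a strict inequality.
  Subtracting a small constant \<open>e\<close> from \<open>w\<close> achieves this because \<open>(\<Delta> - 2) e = - 2 e\<close>, and it does not
  disturb the boundary values, as \<open>e / x\<^sub>0\<close> tends to \<open>0\<close> at infinity.\<close>

lemma maximum_principle: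
  assumes w: "smooth_H2 w" and L: "\<And>q. massive_laplacian (w \<circ> hparam) q = 0"
    and g: "continuous_on (cball 0 1) g" "\<And>\<eta>. \<eta> \<in> ball 0 1 \<Longrightarrow> g \<eta> = ubar w \<eta>" "\<And>z. z \<in> sphere 0 1 \<Longrightarrow> g z = 0"
  shows "w (hparam q0) \<le> 0"
proof (rule ccontr)
  let ?f = "w \<circ> hparam"
  assume "\<not> w (hparam q0) \<le> 0"
  then have pos: "?f q0 > 0" by simp
  define e where "e = ?f q0 / 2"
  have e: "e > 0" "?f q0 - e > 0" using pos by (simp_all add: e_def)
  \<comment> \<open>This is \<open>(w - e) / x\<^sub>0\<close> on the disk.\<close>
  define K where "K \<eta> = g \<eta> - e * sqrt (1 - (cmod \<eta>)\<^sup>2)" for \<eta>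
  have "continuous_on (cball 0 1) K"
    unfolding K_def by (intro continuous_intros g(1))
  then obtain \<eta> where \<eta>: "\<eta> \<in> cball 0 1" "\<And>\<zeta>. \<zeta> \<in> cball 0 1 \<Longrightarrow> K \<zeta> \<le> K \<eta>"
    using continuous_attains_sup[of "cball 0 1" K] by auto
  have K_Klein: "K (Klein (hparam q)) = (?f q - e) / height q" for q
    using g(2)[OF Klein_hparam_in_ball, of q] ubar_Klein[of w q]
    by (simp add: K_def cmod_Klein_hparam real_sqrt_divide diff_divide_distrib)
  have le: "(?f q - e) / height q \<le> K \<eta>" for q
    unfolding K_Klein[symmetric] using Klein_hparam_in_ball[of q] by (intro \<eta>(2)) auto
  have "(?f q0 - e) / height q0 > 0" using e by simp
  then have K_pos: "K \<eta> > 0" using le[of q0] by linarith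
  have "\<eta> \<in> ball 0 1"
  proof (rule ccontr)
    assume "\<eta> \<notin> ball 0 1"
    then have "\<eta> \<in> sphere 0 1" using \<eta>(1) by simp
    then have "K \<eta> = 0" using g(3) by (simp add: K_def)
    then show False using K_pos by simp
  qed
  then obtain q where q: "\<eta> = Klein (hparam q)" using Klein_klein_coords by metis
  define P where "P x = (?f x - e * 1) - K \<eta> * height x" for x
  have P_le: "P x \<le> 0" for x
    using le[of x] by (simp add: P_def divide_le_eq)
  have Pq: "P q = 0"
    using K_Klein[of q] by (simp add: P_def q[symmetric])
  have sm: "smooth_fun ?f" using w by (simp add: smooth_H2_def)
  have df: "?f differentiable (at x)" "partial_d j ?f differentiable (at x)" for j x
    using sm by (auto intro: smooth_fun_differentiable smooth_fun_partial_d)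
  have d1: "(\<lambda>q::real^2. 1::real) differentiable (at x)" "partial_d j (\<lambda>q::real^2. 1::real) differentiable (at x)" for j x
    by (simp_all add: partial_d_const_fun)
  have ph: "partial_d j height = (\<lambda>q. q $ j / height q)" for j by (simp add: fun_eq_iff)
  have dh: "height differentiable (at x)" "partial_d j height differentiable (at x)" for j x
    unfolding ph by simp_all
  let ?f1 = "\<lambda>q. ?f q - e * 1"
  have df1: "?f1 differentiable (at x)" "partial_d j ?f1 differentiable (at x)" for j x
    unfolding massive_laplacian_diff(2)[OF df d1]
    by (intro differentiable_diff differentiable_mult differentiable_const df d1)+
  have P_eq: "P = (\<lambda>x. ?f1 x - K \<eta> * height x)" by (simp add: P_def fun_eq_iff)
  have dP: "P differentiable (at x)" "partial_d j P differentiable (at x)" for j x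
    unfolding P_eq massive_laplacian_diff(2)[OF df1 dh]
    by (intro differentiable_diff[OF _ differentiable_mult[OF differentiable_const]] df1 dh)+
  have "massive_laplacian P q = 2 * e"
    unfolding P_eq massive_laplacian_diff(1)[OF df1 dh] massive_laplacian_diff(1)[OF df d1]
    by (simp only: L massive_laplacian_height massive_laplacian_of_const)
  moreover have "massive_laplacian P q \<le> 0"
  proof -
    note crit = second_derivative_le_0_at_max[OF dP, of q]
    have mx: "P y \<le> P q" for y using P_le Pq by simp
    \<comment> \<open>The coefficient matrix \<open>\<delta>\<^sub>i\<^sub>j + q\<^sub>i q\<^sub>j\<close> is the sum of the squares of \<open>e\<^sub>1\<close>, \<open>e\<^sub>2\<close> and \<open>q\<close>.\<close>
    have "massive_laplacian P q =
       (\<Sum>i\<in>UNIV. \<Sum>j\<in>UNIV. axis 1 1 $ i * axis 1 1 $ j * partial_d i (partial_d j P) q)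
       + (\<Sum>i\<in>UNIV. \<Sum>j\<in>UNIV. axis 2 1 $ i * axis 2 1 $ j * partial_d i (partial_d j P) q)
       + (\<Sum>i\<in>UNIV. \<Sum>j\<in>UNIV. q $ i * q $ j * partial_d i (partial_d j P) q)"
      unfolding massive_laplacian_def crit(1)[OF mx] Pq by (simp add: sum_2 axis_def algebra_simps)
    also have "\<dots> \<le> 0 + 0 + 0" by (intro add_mono crit(2) mx)
    finally show ?thesis by simp
  qed
  ultimately show False using e by simp
qed

lemma boundary_value_unique:
  assumes v: "smooth_H2 v" "\<And>q. massive_laplacian (v \<circ> hparam) q = 0"
      "continuous_on (cball 0 1) g" "\<And>\<eta>. \<eta> \<in> ball 0 1 \<Longrightarrow> g \<eta> = ubar v \<eta>"
    and w: "smooth_H2 w" "\<And>q. massive_laplacian (w \<circ> hparam) q = 0"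
      "continuous_on (cball 0 1) h" "\<And>\<eta>. \<eta> \<in> ball 0 1 \<Longrightarrow> h \<eta> = ubar w \<eta>"
    and eq: "\<And>z. z \<in> sphere 0 1 \<Longrightarrow> g z = h z"
  shows "v (hparam q) \<le> w (hparam q)"
proof -
  let ?d = "\<lambda>p. v p - w p"
  have comp: "?d \<circ> hparam = (\<lambda>q. (v \<circ> hparam) q - 1 * (w \<circ> hparam) q)" by (simp add: fun_eq_iff)
  have sv: "smooth_fun (v \<circ> hparam)" and sw: "smooth_fun (w \<circ> hparam)" using v w by (simp_all add: smooth_H2_def)
  have "?d (hparam q) \<le> 0"
  proof (rule maximum_principle)
    show "smooth_H2 ?d"
      unfolding smooth_H2_def comp using smooth_fun_diff[OF sv sw] by simp
    show "massive_laplacian (?d \<circ> hparam) q = 0" for q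
      unfolding comp
      by (subst massive_laplacian_diff(1))
        (use v(2) w(2) sv sw in \<open>auto intro: smooth_fun_differentiable smooth_fun_partial_d\<close>)
    show "continuous_on (cball 0 1) (\<lambda>\<eta>. g \<eta> - h \<eta>)" by (intro continuous_intros v w)
    show "g \<eta> - h \<eta> = ubar ?d \<eta>" if "\<eta> \<in> ball 0 1" for \<eta>
      using v(4)[OF that] w(4)[OF that] by (simp add: ubar_def algebra_simps)
    show "g z - h z = 0" if "z \<in> sphere 0 1" for z using eq[OF that] by simp
  qed
  then show ?thesis by simp
qed

text \<open>If \<open>(\<Delta> - 2) u = k\<close>, then \<open>u + k/2\<close> solves the homogeneous equation, has the same boundary values and the same
  gradient.\<close>

lemma V_gr_u_ext:
  assumes u: "smooth_H2 u" and k: "\<And>q. massive_laplacian (u \<circ> hparam) q = k"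
    and g: "continuous_on (cball 0 1) g" "\<And>\<eta>. \<eta> \<in> ball 0 1 \<Longrightarrow> g \<eta> = ubar u \<eta>"
    and p: "p \<in> H2"
  shows "V_gr u p = HL (\<lambda>z. \<i> * z * of_real (g z)) p"
proof -
  let ?f = "u \<circ> hparam" and ?X = "\<lambda>z. \<i> * z * complex_of_real (g z)"
  define w where "w = restrict (\<lambda>p. u p + k / 2) H2"
  have comp: "w \<circ> hparam = (\<lambda>q. ?f q - (- k / 2) * 1)"
    by (simp add: w_def fun_eq_iff hparam_in_H2)
  have sm: "smooth_fun ?f" using u by (simp add: smooth_H2_def)
  have d: "?f differentiable (at x)" "partial_d j ?f differentiable (at x)"
    "(\<lambda>q::real^2. 1::real) differentiable (at x)" "partial_d j (\<lambda>q::real^2. 1::real) differentiable (at x)" for j x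
    using sm by (auto intro: smooth_fun_differentiable smooth_fun_partial_d simp: partial_d_const_fun)
  have sw: "smooth_H2 w"
    unfolding smooth_H2_def comp using smooth_fun_diff[OF sm smooth_fun_const[of "- k / 2"]] by simp
  have lw: "massive_laplacian (w \<circ> hparam) q = 0" for q
    unfolding comp massive_laplacian_diff(1)[OF d] massive_laplacian_of_const k by simp
  \<comment> \<open>The extension of \<open>ubar w\<close>: a constant becomes a multiple of \<open>sqrt (1 - \<bar>\<eta>\<bar>\<^sup>2)\<close> in the Klein model.\<close>
  define h where "h \<eta> = g \<eta> + (k / 2) * sqrt (1 - (cmod \<eta>)\<^sup>2)" for \<eta>
  have ch: "continuous_on (cball 0 1) h" unfolding h_def by (intro continuous_intros g(1))
  have hu: "h \<eta> = ubar w \<eta>" if "\<eta> \<in> ball 0 1" for \<eta>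
    using g(2)[OF that] unfolding ubar_eq[OF that] comp h_def by (simp add: algebra_simps)
  have hs: "h z = g z" if "z \<in> sphere 0 1" for z using that by (simp add: h_def)
  let ?Q = "\<lambda>u. u \<in> extensional H2 \<and> smooth_H2 u
     \<and> (\<forall>p\<in>H2. laplace_H2 u p - 2 * u p = 0)
     \<and> (\<exists>\<phi>. (\<forall>z\<in>sphere 0 1. ?X z = \<i> * z * of_real (\<phi> z)) \<and> boundary_is_graph u \<phi>)"
  have "u_ext ?X = w"
    unfolding u_ext_def
  proof (rule the_equality)
    show "?Q w"
    proof (intro conjI ballI exI[of _ g])
      show "w \<in> extensional H2" by (simp add: w_def)
      show "laplace_H2 w p - 2 * w p = 0" if "p \<in> H2" for p using laplace_H2_eq[OF that, of w] lw by simp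
      show "boundary_is_graph w g"
        unfolding boundary_is_graph_def using ch hu hs by blast
    qed (use sw in auto)
    fix v assume Q: "?Q v"
    then obtain \<phi> h' where \<phi>: "\<And>z. z \<in> sphere 0 1 \<Longrightarrow> ?X z = \<i> * z * of_real (\<phi> z)"
      and h': "continuous_on (cball 0 1) h'" "\<And>\<eta>. \<eta> \<in> ball 0 1 \<Longrightarrow> h' \<eta> = ubar v \<eta>" "\<And>z. z \<in> sphere 0 1 \<Longrightarrow> h' z = \<phi> z"
      unfolding boundary_is_graph_def by blast
    have same: "h z = h' z" if "z \<in> sphere 0 1" for z
    proof -
      have "z \<noteq> 0" using that by auto
      then have "g z = \<phi> z" using \<phi>[OF that] by simp
      then show ?thesis using hs[OF that] h'(3)[OF that] by simp
    qed
    have sv: "smooth_H2 v" using Q by blast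
    have lv: "massive_laplacian (v \<circ> hparam) q = 0" for q
      using Q laplace_H2_eq[OF hparam_in_H2, of v q] hparam_in_H2[of q] by (simp add: hchart_hparam)
    have "v (hparam q) = w (hparam q)" for q
      using boundary_value_unique[OF sv lv h'(1,2) sw lw ch hu] boundary_value_unique[OF sw lw ch hu sv lv h'(1,2)] same
      by (metis antisym)
    then have "v p = w p" if "p \<in> H2" for p using hparam_hchart[OF that] by metis
    then show "v = w" using Q by (intro extensionalityI[of v H2 w]) (auto simp: w_def)
  qed
  moreover have "partial_d j (w \<circ> hparam) q = partial_d j ?f q" for j q
    unfolding comp massive_laplacian_diff(2)[OF d] by (simp add: partial_d_const_fun)
  ultimately show ?thesis
    using V_gr_hparam[OF u, of "hchart p"] V_gr_hparam[OF sw, of "hchart p"]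
    by (simp add: HL_def hparam_hchart[OF p])
qed

theorem proposition1p8:
  fixes u :: "real^3 \<Rightarrow> real"
  assumes "smooth_H2 u"
    and "harmonic_Lagrangian (V_gr u)"
    and "dbar_norm (V_gr u) < \<infinity>"
  shows "\<exists>\<phi> :: complex \<Rightarrow> real. continuous_on (sphere 0 1) \<phi> \<and> boundary_is_graph u \<phi> \<and>
     (let X = (\<lambda>z. \<i> * z * of_real (\<phi> z)) in
        (\<forall>p\<in>H2. V_gr u p = HL X p) \<and> extends_continuously_to (V_gr u) X)"
proof -
  let ?f = "u \<circ> hparam"
  note u = assms(1)
  have sm: "smooth_fun ?f" using u by (simp add: smooth_H2_def)
  have "\<exists>k. \<forall>q. massive_laplacian ?f q = k"
    by (rule massive_laplacian_eq_const[OF sm _ vf_coords_V_gr[OF u]])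
      (use assms(2) in \<open>simp add: harmonic_Lagrangian_def\<close>)
  then obtain k where k: "\<And>q. massive_laplacian ?f q = k" by blast
  obtain M where M: "M \<ge> 0" "\<And>q. norm (hess_op ?f q q) \<le> M * norm q"
    using hess_op_radial_bound[OF u k assms(3)] by blast
  have growth: "cmod (klein_grad ?f q) \<le> cmod (klein_grad ?f 0) + M * norm q" for q
    by (rule klein_grad_growth[OF sm M(2)])
  obtain g where g: "continuous_on (cball 0 1) g" "\<And>\<eta>. \<eta> \<in> ball 0 1 \<Longrightarrow> g \<eta> = ubar u \<eta>"
    using ubar_extends[OF u norm_ge_zero M(1) growth] by blast
  show ?thesis
    unfolding Let_def
  proof (intro exI[of _ g] conjI ballI)
    show "continuous_on (sphere 0 1) g" using g(1) by (rule continuous_on_subset) auto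
    show "boundary_is_graph u g" unfolding boundary_is_graph_def using g by blast
    show "V_gr u p = HL (\<lambda>z. \<i> * z * of_real (g z)) p" if "p \<in> H2" for p
      by (rule V_gr_u_ext[OF u k g that])
    show "extends_continuously_to (V_gr u) (\<lambda>z. \<i> * z * of_real (g z))"
      by (rule V_gr_extends_continuously[OF u M(1) growth g])
  qed
qed

end
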